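(* On the square lattice, the $+$-shaped pentomino (one unit square together with the four unit squares sharing an edge with it), which has $5$ plaquettes and $N=16$ qubits, is the smallest toric code setup without LC-equivalent local graph state. That is: (i) no graph state that is LC-equivalent to the toric code ground state of the $+$-shaped pentomino is local with respect to this setup; (ii) every polyomino with fewer than $5$ squares or with fewer than $16$ qubits has a toric code ground state that is LC-equivalent to some graph state that is local with respect to that polyomino.
   Context: A polyomino is a finite nonempty edge-connected set of unit squares of the square lattice (tiling of the plane by unit squares). It defines a toric code setup as follows. Let $\mathcal{L}$ be the plane graph whose vertices and edges are the corners and sides of the squares of the polyomino. One qubit is placed on each edge of $\mathcal{L}$. For each vertex $s$ of $\mathcal{L}$ the star operator is $A_s=\prod_{i\ni s}\sigma^x_i$ (product over the edges of $\mathcal{L}$ incident to $s$). For each square $p$ of the polyomino (plaquette) the plaquette operator is $B_p=\prod_{i\in p}\sigma^z_i$ (product over the four sides of $p$); there is no plaquette operator for the outer region. The toric code ground state is the state, unique up to phase, that is fixed by all $A_s$ and by $\prod_{i\in\mathcal{C}}\sigma_i^z$ for every cycle $\mathcal{C}$ of $\mathcal{L}$ (for a polyomino without holes this is the same as being fixed by all $A_s$ and all $B_p$). Two distinct qubits are vicinal in the setup if both belong to the support of at least one common star operator $A_s$ or plaquette operator $B_p$, i.e. the two edges share a vertex or are sides of the same square of the polyomino. For a simple graph $G$ with neighbourhoods $N_v$, whose vertices are identified with the qubits, the graph state $|G\rangle$ is the state (unique up to phase) fixed by $\sigma^x_v\prod_{w\in N_v}\sigma^z_w$ for all vertices $v$.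 A graph (state) on the qubits of the setup is local with respect to the setup if every edge of $G$ joins two qubits that are vicinal in the setup. The Pauli group $G_1$ is generated by $\sigma^x,\sigma^y,\sigma^z$, the Clifford group is $C_1=\{U\in U(2):UG_1U^\dagger=G_1\}$, and two $N$-qubit states are LC-equivalent if one is obtained from the other by applying an element of $\bigotimes_{i=1}^N C_1^{(i)}$. *)

theory Defs
  imports "HOL-Analysis.Analysis"
begin

section \<open>Polyominoes and their plane graphs\<close>

text \<open>The cell \<open>(a, b)\<close> is the unit square \<open>[a, a+1] \<times> [b, b+1]\<close>. An edge of the plane graph, and hence
  a qubit, is the two-element set of its end points.\<close>

type_synonym cell = "int \<times> int"
type_synonym vertex = "int \<times> int"
type_synonym qubit = "vertex set"

definition cell_adj :: "cell \<Rightarrow> cell \<Rightarrow> bool" where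
  "cell_adj p q \<longleftrightarrow> \<bar>fst p - fst q\<bar> + \<bar>snd p - snd q\<bar> = 1"

definition polyomino :: "cell set \<Rightarrow> bool" where
  "polyomino P \<longleftrightarrow> finite P \<and> P \<noteq> {} \<and>
     (\<forall>p\<in>P. \<forall>q\<in>P. (p, q) \<in> {(x, y). x \<in> P \<and> y \<in> P \<and> cell_adj x y}\<^sup>*)"

fun corners :: "cell \<Rightarrow> vertex set" where
  "corners (a, b) = {(a, b), (a + 1, b), (a, b + 1), (a + 1, b + 1)}"

fun sides :: "cell \<Rightarrow> qubit set" where
  "sides (a, b) =
     {{(a, b), (a + 1, b)}, {(a, b + 1), (a + 1, b + 1)},
      {(a, b), (a, b + 1)}, {(a + 1, b), (a + 1, b + 1)}}"

definition verts :: "cell set \<Rightarrow> vertex set" where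
  "verts P = (\<Union>p\<in>P. corners p)"

definition qubits :: "cell set \<Rightarrow> qubit set" where
  "qubits P = (\<Union>p\<in>P. sides p)"

definition star :: "cell set \<Rightarrow> vertex \<Rightarrow> qubit set" where
  "star P s = {e \<in> qubits P. s \<in> e}"

definition is_cycle :: "cell set \<Rightarrow> qubit set \<Rightarrow> bool" where
  "is_cycle P C \<longleftrightarrow> C \<subseteq> qubits P \<and>
     (\<exists>vs. distinct vs \<and> length vs \<ge> 3 \<and>
        C = (\<lambda>i. {vs ! i, vs ! (Suc i mod length vs)}) ` {..<length vs})"

definition plus_pentomino :: "cell set" where
  "plus_pentomino = {(0, 0), (1, 0), (-1, 0), (0, 1), (0, -1)}"

definition vicinal :: "cell set \<Rightarrow> qubit \<Rightarrow> qubit \<Rightarrow> bool" where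
  "vicinal P e f \<longleftrightarrow> e \<noteq> f \<and>
     ((\<exists>s\<in>verts P. e \<in> star P s \<and> f \<in> star P s) \<or> (\<exists>p\<in>P. e \<in> sides p \<and> f \<in> sides p))"


section \<open>Qubits, Paulis and Cliffords\<close>

text \<open>One-qubit operators are matrices indexed by \<^typ>\<open>bool\<close>, with \<^term>\<open>False\<close> for the basis vector
  \<open>|0\<rangle>\<close> and \<^term>\<open>True\<close> for \<open>|1\<rangle>\<close>; the first index is the row.\<close>

type_synonym qubit_op = "complex^bool^bool"

definition sigma_x :: qubit_op where
  "sigma_x = (\<chi> a b. if a = b then 0 else 1)"

definition sigma_y :: qubit_op where
  "sigma_y = (\<chi> a b. if a = b then 0 else if a then \<i> else - \<i>)"

definition sigma_z :: qubit_op where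
  "sigma_z = (\<chi> a b. if a \<noteq> b then 0 else if a then - 1 else 1)"

definition conj_transpose :: "qubit_op \<Rightarrow> qubit_op" where
  "conj_transpose U = (\<chi> a b. cnj (U $ b $ a))"

definition unitary_op :: "qubit_op \<Rightarrow> bool" where
  "unitary_op U \<longleftrightarrow> U ** conj_transpose U = mat 1 \<and> conj_transpose U ** U = mat 1"

text \<open>The generators are involutions, so closure under products already gives a group.\<close>

inductive_set pauli_group :: "qubit_op set" where
  one: "mat 1 \<in> pauli_group"
| x: "sigma_x \<in> pauli_group"
| y: "sigma_y \<in> pauli_group"
| z: "sigma_z \<in> pauli_group"
| mult: "A \<in> pauli_group \<Longrightarrow> B \<in> pauli_group \<Longrightarrow> A ** B \<in> pauli_group"

definition clifford_group :: "qubit_op set" where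
  "clifford_group =
     {U. unitary_op U \<and> (\<lambda>g. U ** g ** conj_transpose U) ` pauli_group = pauli_group}"

text \<open>A state of a finite set \<open>Q\<close> of qubits is given by its amplitudes in the computational basis. The
  basis vectors are labelled by the subsets of \<open>Q\<close>: the subset \<open>S\<close> stands for the basis vector in which
  exactly the qubits in \<open>S\<close> are in state \<open>|1\<rangle>\<close>.\<close>

type_synonym 'q amplitudes = "'q set \<Rightarrow> complex"

definition state :: "'q set \<Rightarrow> 'q amplitudes \<Rightarrow> bool" where
  "state Q \<psi> \<longleftrightarrow> (\<forall>S. \<not> S \<subseteq> Q \<longrightarrow> \<psi> S = 0) \<and> (\<Sum>S\<in>Pow Q. (cmod (\<psi> S))\<^sup>2) = 1"

text \<open>The action of the tensor product of the \<open>U i\<close> over \<open>i \<in> Q\<close>.\<close>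

definition tensor_op :: "'q set \<Rightarrow> ('q \<Rightarrow> qubit_op) \<Rightarrow> 'q amplitudes \<Rightarrow> 'q amplitudes" where
  "tensor_op Q U \<psi> = (\<lambda>S. if S \<subseteq> Q
     then \<Sum>T\<in>Pow Q. (\<Prod>i\<in>Q. U i $ (i \<in> S) $ (i \<in> T)) * \<psi> T else 0)"

text \<open>The product over \<open>i \<in> A\<close> of the one-qubit operator \<open>M\<close> at qubit \<open>i\<close>.\<close>

definition prod_op :: "'q set \<Rightarrow> 'q set \<Rightarrow> qubit_op \<Rightarrow> 'q amplitudes \<Rightarrow> 'q amplitudes" where
  "prod_op Q A M = tensor_op Q (\<lambda>i. if i \<in> A then M else mat 1)"

definition lc_equivalent :: "'q set \<Rightarrow> 'q amplitudes \<Rightarrow> 'q amplitudes \<Rightarrow> bool" where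
  "lc_equivalent Q \<psi> \<phi> \<longleftrightarrow> (\<exists>U. (\<forall>i\<in>Q. U i \<in> clifford_group) \<and> \<phi> = tensor_op Q U \<psi>)"


section \<open>Toric code ground states and graph states\<close>

definition toric_ground_state :: "cell set \<Rightarrow> qubit amplitudes \<Rightarrow> bool" where
  "toric_ground_state P \<psi> \<longleftrightarrow> state (qubits P) \<psi> \<and>
     (\<forall>s\<in>verts P. prod_op (qubits P) (star P s) sigma_x \<psi> = \<psi>) \<and>
     (\<forall>C. is_cycle P C \<longrightarrow> prod_op (qubits P) C sigma_z \<psi> = \<psi>)"

text \<open>Simple graphs on \<open>Q\<close> are given by their adjacency relations; \<open>G `` {v}\<close> is the neighbourhood of \<open>v\<close>.\<close>

definition simple_graph :: "'q set \<Rightarrow> ('q \<times> 'q) set \<Rightarrow> bool" where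
  "simple_graph Q G \<longleftrightarrow> G \<subseteq> Q \<times> Q \<and> sym G \<and> irrefl G"

definition graph_state :: "'q set \<Rightarrow> ('q \<times> 'q) set \<Rightarrow> 'q amplitudes \<Rightarrow> bool" where
  "graph_state Q G \<phi> \<longleftrightarrow> state Q \<phi> \<and>
     (\<forall>v\<in>Q. prod_op Q {v} sigma_x (prod_op Q (G `` {v}) sigma_z \<phi>) = \<phi>)"

definition local_graph :: "cell set \<Rightarrow> (qubit \<times> qubit) set \<Rightarrow> bool" where
  "local_graph P G \<longleftrightarrow> (\<forall>(e, f)\<in>G. vicinal P e f)"

end

(*
Suppose every square p has a private side f p, one that is not a side of another square. The edges
outside these private ones form a spanning tree, so a Hadamard gate on every f p turns the ground
state into the graph state in which f p is adjacent to the other three sides of p. A square without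
a private side has four neighbours, and counting edges column by column and row by row shows that
this takes at least five squares and 16 qubits.

For the plus, pull the graph state generators back to Pauli stabilizers of the ground state; they
commute with all stars and plaquettes. If the inner sides e, e' of two opposite arms were adjacent,
these parity conditions would force the pulled back sigma^z to be sigma^x on both outward sides of a
third arm, contradicting the generator there. So opposite arms are not adjacent; but the four arms
share a GHZ state, and a graph on them without opposite edges cannot represent it.
*)
theory Submission imports Defs begin

section \<open>Tensor products of one-qubit operators\<close>

text \<open>Expanding the product means choosing a Boolean at every site, and the choices are the
  subsets of \<open>Q\<close>. This turns a sum over intermediate basis vectors into sitewise matrix
  products.\<close>

lemma prod_bool_sum:
  fixes f :: "'q \<Rightarrow> bool \<Rightarrow> 'c::comm_semiring_1"
  assumes "finite Q"
  shows "(\<Prod>i\<in>Q. \<Sum>t\<in>UNIV. f i t) = (\<Sum>T\<in>Pow Q. \<Prod>i\<in>Q. f i (i \<in> T))"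
proof -
  have "(\<Prod>i\<in>Q. f i (i \<in> T)) = (\<Prod>i\<in>T. f i True) * (\<Prod>i\<in>Q - T. f i False)" if "T \<in> Pow Q" for T
  proof -
    have "(\<Prod>i\<in>Q. f i (i \<in> T)) = (\<Prod>i\<in>T. f i (i \<in> T)) * (\<Prod>i\<in>Q - T. f i (i \<in> T))"
      using that assms by (subst prod.subset_diff[of T Q]) (auto simp: mult.commute)
    then show ?thesis
      by simp
  qed
  then show ?thesis
    using prod_add[OF assms, of "\<lambda>i. f i True" "\<lambda>i. f i False"]
    by (simp add: UNIV_bool add.commute)
qed

lemma matrix_mult_bool:
  "((A::'c::semiring_1^bool^bool) ** B) $ a $ b = A $ a $ False * B $ False $ b + A $ a $ True * B $ True $ b"
  by (simp add: matrix_matrix_mult_def UNIV_bool)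

lemma tensor_op_cong:
  assumes "\<And>i. i \<in> Q \<Longrightarrow> A i = B i"
  shows "tensor_op Q A = tensor_op Q B"
  using assms by (simp add: tensor_op_def fun_eq_iff cong: prod.cong)

lemma tensor_op_comp:
  assumes "finite Q"
  shows "tensor_op Q A (tensor_op Q B \<psi>) = tensor_op Q (\<lambda>i. A i ** B i) \<psi>"
proof
  fix S
  have "(\<Sum>T\<in>Pow Q. (\<Prod>i\<in>Q. A i $ (i \<in> S) $ (i \<in> T)) *
          (\<Sum>R\<in>Pow Q. (\<Prod>i\<in>Q. B i $ (i \<in> T) $ (i \<in> R)) * \<psi> R))
      = (\<Sum>R\<in>Pow Q. \<Sum>T\<in>Pow Q. (\<Prod>i\<in>Q. A i $ (i \<in> S) $ (i \<in> T) * B i $ (i \<in> T) $ (i \<in> R)) * \<psi> R)"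
    by (subst sum.swap) (simp add: sum_distrib_left prod.distrib mult.assoc)
  also have "\<dots> = (\<Sum>R\<in>Pow Q. (\<Prod>i\<in>Q. (A i ** B i) $ (i \<in> S) $ (i \<in> R)) * \<psi> R)"
    by (simp add: matrix_matrix_mult_def sum_distrib_right[symmetric]
        prod_bool_sum[OF assms, of "\<lambda>i t. A i $ (i \<in> S) $ t * B i $ t $ (i \<in> R)" for S R])
  finally show "tensor_op Q A (tensor_op Q B \<psi>) S = tensor_op Q (\<lambda>i. A i ** B i) \<psi> S"
    by (simp add: tensor_op_def)
qed

lemma tensor_op_id:
  assumes "finite Q" "\<And>S. \<not> S \<subseteq> Q \<Longrightarrow> \<psi> S = 0"
  shows "tensor_op Q (\<lambda>i. mat 1) \<psi> = \<psi>"
proof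
  fix S
  have "(\<Prod>i\<in>Q. mat 1 $ (i \<in> S) $ (i \<in> T) :: complex) = (if S = T then 1 else 0)"
    if "S \<subseteq> Q" "T \<subseteq> Q" for T
    using assms(1) that by (auto simp: mat_def intro!: prod_zero)
  then show "tensor_op Q (\<lambda>i. mat 1) \<psi> S = \<psi> S"
    using assms by (auto simp: tensor_op_def if_distrib[of "\<lambda>x. x * _"] sum.delta' cong: if_cong)
qed

lemma tensor_op_scale:
  "tensor_op Q (\<lambda>i. c i *\<^sub>R A i) \<psi> = (\<lambda>S. of_real (\<Prod>i\<in>Q. c i) * tensor_op Q A \<psi> S)"
  by (simp add: tensor_op_def fun_eq_iff sum_distrib_left prod.distrib scaleR_conv_of_real[where 'a=complex] mult.assoc)

lemma tensor_op_adjoint: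
  "(\<Sum>S\<in>Pow Q. cnj (tensor_op Q U \<psi> S) * \<xi> S) =
   (\<Sum>T\<in>Pow Q. cnj (\<psi> T) * tensor_op Q (\<lambda>i. conj_transpose (U i)) \<xi> T)"
  by (simp add: tensor_op_def sum_distrib_left sum_distrib_right conj_transpose_def)
    (subst sum.swap, simp add: mult_ac)

text \<open>The squared norm is the inner product of a vector with itself. Moving \<open>U\<close>
  across it by \<open>tensor_op_adjoint\<close> leaves \<open>conj_transpose (U i) ** U i\<close>,
  the identity, at each site.\<close>

lemma state_tensor_op:
  assumes "finite Q" "state Q \<psi>" "\<And>i. i \<in> Q \<Longrightarrow> unitary_op (U i)"
  shows "state Q (tensor_op Q U \<psi>)"
proof -
  have "tensor_op Q (\<lambda>i. conj_transpose (U i)) (tensor_op Q U \<psi>) = tensor_op Q (\<lambda>i. mat 1) \<psi>"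
    unfolding tensor_op_comp[OF assms(1)] using assms(3)
    by (simp add: unitary_op_def cong: tensor_op_cong)
  also have "\<dots> = \<psi>"
    using assms by (intro tensor_op_id) (auto simp: state_def)
  finally have "(\<Sum>S\<in>Pow Q. cnj (tensor_op Q U \<psi> S) * tensor_op Q U \<psi> S) = (\<Sum>T\<in>Pow Q. cnj (\<psi> T) * \<psi> T)"
    using tensor_op_adjoint[of Q U \<psi> "tensor_op Q U \<psi>"] by simp
  then have "complex_of_real (\<Sum>S\<in>Pow Q. (cmod (tensor_op Q U \<psi> S))\<^sup>2) = complex_of_real (\<Sum>T\<in>Pow Q. (cmod (\<psi> T))\<^sup>2)"
    by (simp add: complex_norm_square mult.commute del: of_real_power)
  then show ?thesis
    using assms(2) unfolding of_real_eq_iff by (simp add: state_def tensor_op_def)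
qed

text \<open>At the sites common to \<open>A\<close> and \<open>B\<close> the involution
  \<open>M\<close> cancels.\<close>

lemma prod_op_comp_sym_diff:
  assumes "finite Q" "M ** M = mat 1"
  shows "prod_op Q A M (prod_op Q B M \<psi>) = prod_op Q ((A - B) \<union> (B - A)) M \<psi>"
  unfolding prod_op_def tensor_op_comp[OF assms(1)]
  by (rule arg_cong[where f = "\<lambda>f. tensor_op Q f \<psi>"]) (auto simp: fun_eq_iff assms(2))

text \<open>Exchanging the two stabilizers multiplies \<psi> by -1 for every site at which they
  anticommute. Since \<psi> is fixed by both and is not zero, the total sign is 1.\<close>

lemma even_anticommuting_sites:
  assumes "finite Q" "state Q \<psi>" "tensor_op Q A \<psi> = \<psi>" "tensor_op Q B \<psi> = \<psi>"
    and comm: "\<And>i. i \<in> Q \<Longrightarrow> A i ** B i = (if p i then -1 else 1 :: real) *\<^sub>R (B i ** A i)"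
  shows "even (card {i\<in>Q. p i})"
proof -
  let ?c = "\<Prod>i\<in>Q. if p i then -1 else 1 :: real"
  have "\<psi> = tensor_op Q A (tensor_op Q B \<psi>)"
    using assms by simp
  also have "\<dots> = tensor_op Q (\<lambda>i. (if p i then -1 else 1 :: real) *\<^sub>R (B i ** A i)) \<psi>"
    unfolding tensor_op_comp[OF assms(1)] by (intro fun_cong[OF tensor_op_cong] comm)
  also have "\<dots> = (\<lambda>S. of_real ?c * tensor_op Q B (tensor_op Q A \<psi>) S)"
    unfolding tensor_op_comp[OF assms(1)] tensor_op_scale ..
  finally have eq: "\<psi> = (\<lambda>S. of_real ?c * \<psi> S)"
    using assms by simp
  have "\<exists>S. \<psi> S \<noteq> 0"
  proof (rule ccontr)
    assume "\<nexists>S. \<psi> S \<noteq> 0"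
    then show False
      using assms(2) by (simp add: state_def)
  qed
  then have "?c = 1"
    using fun_cong[OF eq] by (metis mult_cancel_right1 of_real_eq_1_iff)
  moreover have "?c = (-1) ^ card {i\<in>Q. p i}"
    using assms(1) by (simp add: prod.If_cases Int_def)
  ultimately show ?thesis
    by (simp add: minus_one_power_iff split: if_splits)
qed

section \<open>Pauli operators and Clifford operators\<close>

text \<open>\<open>weyl c x z\<close> is the operator \<open>c X^x Z^z\<close>.\<close>

definition weyl :: "complex \<Rightarrow> bool \<Rightarrow> bool \<Rightarrow> qubit_op" where
  "weyl c x z = (\<chi> a b. if (a \<noteq> b) = x then (if z \<and> b then - c else c) else 0)"

lemma weyl_mult: "weyl c x z ** weyl d x' z' = weyl (if z \<and> x' then - (c * d) else c * d) (x \<noteq> x') (z \<noteq> z')"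
  by (cases x; cases z; cases x'; cases z') (simp_all add: vec_eq_iff matrix_mult_bool weyl_def all_bool_eq)

lemma weyl_uminus: "weyl (- c) x z = - weyl c x z"
  by (simp add: vec_eq_iff weyl_def)

text \<open>The sign is the symplectic form of the bit pairs \<open>(x, z)\<close> and
  \<open>(x', z')\<close>.\<close>

lemma weyl_commute:
  "weyl c x z ** weyl d x' z' =
    (if (x \<and> z') \<noteq> (z \<and> x') then -1 else 1 :: real) *\<^sub>R (weyl d x' z' ** weyl c x z)"
  by (cases x; cases z; cases x'; cases z') (simp_all add: weyl_mult weyl_uminus mult.commute[of d c])

lemma sigma_eq_weyl:
  "mat 1 = weyl 1 False False" "sigma_x = weyl 1 True False"
  "sigma_y = weyl \<i> True True" "sigma_z = weyl 1 False True"
  by (auto simp: vec_eq_iff weyl_def mat_def sigma_x_def sigma_y_def sigma_z_def)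

lemma pauli_group_weyl: "g \<in> pauli_group \<Longrightarrow> \<exists>c x z. c \<noteq> 0 \<and> g = weyl c x z"
proof (induction rule: pauli_group.induct)
  case (mult A B)
  then obtain c x z d x' z' where "c \<noteq> 0" "A = weyl c x z" "d \<noteq> 0" "B = weyl d x' z'"
    by blast
  then show ?case
    by (intro exI[of _ "if z \<and> x' then - (c * d) else c * d"] exI[of _ "x \<noteq> x'"] exI[of _ "z \<noteq> z'"])
      (simp add: weyl_mult)
next
  case one
  show ?case
    unfolding sigma_eq_weyl by (metis one_neq_zero)
next
  case x
  show ?case
    unfolding sigma_eq_weyl by (metis one_neq_zero)
next
  case y
  show ?case
    unfolding sigma_eq_weyl by (metis complex_i_not_zero)
next
  case z
  show ?case
    unfolding sigma_eq_weyl by (metis one_neq_zero)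
qed

text \<open>Conjugation by \<open>U\<close> maps the Pauli group onto itself, so the inverse
  conjugation also yields Pauli operators. The last condition says that the two images anticommute:
  if they commuted, so would \<open>sigma_x\<close> and \<open>sigma_z\<close>.\<close>

lemma clifford_conj_weyl:
  assumes "U \<in> clifford_group"
  obtains c ax az d bx bz where
    "conj_transpose U ** sigma_x ** U = weyl c ax az" "conj_transpose U ** sigma_z ** U = weyl d bx bz"
    "(ax \<and> bz) \<noteq> (az \<and> bx)"
proof -
  have inv: "U ** conj_transpose U = mat 1" "conj_transpose U ** U = mat 1"
    using assms by (auto simp: clifford_group_def unitary_op_def)
  have "\<exists>c x z. c \<noteq> 0 \<and> conj_transpose U ** s ** U = weyl c x z" if s: "s \<in> pauli_group" for s
  proof -
    obtain g where g: "g \<in> pauli_group" "s = U ** g ** conj_transpose U"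
      using assms s by (auto simp: clifford_group_def)
    have "conj_transpose U ** s ** U = (conj_transpose U ** U) ** g ** (conj_transpose U ** U)"
      unfolding g(2) by (simp only: matrix_mul_assoc)
    then show ?thesis
      using pauli_group_weyl[OF g(1)] by (simp add: inv)
  qed
  from this[OF pauli_group.x] this[OF pauli_group.z] obtain c ax az d bx bz where
    w: "c \<noteq> 0" "conj_transpose U ** sigma_x ** U = weyl c ax az"
      "d \<noteq> 0" "conj_transpose U ** sigma_z ** U = weyl d bx bz"
    by blast
  have prod: "(conj_transpose U ** s ** U) ** (conj_transpose U ** t ** U) = conj_transpose U ** (s ** t) ** U"
    for s t
  proof -
    have "(conj_transpose U ** s ** U) ** (conj_transpose U ** t ** U)
        = conj_transpose U ** s ** (U ** conj_transpose U) ** t ** U"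
      by (simp only: matrix_mul_assoc)
    then show ?thesis
      by (simp add: inv matrix_mul_assoc)
  qed
  have "weyl c ax az ** weyl d bx bz \<noteq> weyl d bx bz ** weyl c ax az"
  proof
    assume "weyl c ax az ** weyl d bx bz = weyl d bx bz ** weyl c ax az"
    then have "conj_transpose U ** (sigma_x ** sigma_z) ** U = conj_transpose U ** (sigma_z ** sigma_x) ** U"
      unfolding w(2,4)[symmetric] prod .
    then have "U ** (conj_transpose U ** (sigma_x ** sigma_z) ** U) ** conj_transpose U
       = U ** (conj_transpose U ** (sigma_z ** sigma_x) ** U) ** conj_transpose U"
      by simp
    moreover have "U ** (conj_transpose U ** s ** U) ** conj_transpose U
       = (U ** conj_transpose U) ** s ** (U ** conj_transpose U)" for s
      by (simp only: matrix_mul_assoc)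
    ultimately have "sigma_x ** sigma_z = sigma_z ** sigma_x"
      by (simp add: inv)
    then show False
      by (simp add: vec_eq_iff matrix_mult_bool all_bool_eq sigma_x_def sigma_z_def)
  qed
  then have "(ax \<and> bz) \<noteq> (az \<and> bx)"
    by (subst (asm) (1) weyl_commute) (auto split: if_splits)
  then show ?thesis
    using w that by blast
qed

section \<open>The Hadamard gate and the identity as Clifford operators\<close>

definition hadamard :: qubit_op where
  "hadamard = (\<chi> a b. if a \<and> b then - (1 / sqrt 2) else 1 / sqrt 2)"

lemma half_sqrt2: "complex_of_real (1 / sqrt 2) * complex_of_real (1 / sqrt 2) = 1 / 2"
  unfolding of_real_mult[symmetric] by simp

lemma hadamard_mult:
  "hadamard ** hadamard = mat 1" "conj_transpose hadamard = hadamard"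
  "sigma_x ** hadamard = hadamard ** sigma_z" "sigma_z ** hadamard = hadamard ** sigma_x"
  using half_sqrt2
  by (simp_all add: vec_eq_iff matrix_mult_bool hadamard_def mat_def all_bool_eq conj_transpose_def
      sigma_x_def sigma_z_def)

lemma hadamard_clifford: "hadamard \<in> clifford_group"
proof -
  have mul: "hadamard ** (A ** B) ** hadamard = (hadamard ** A ** hadamard) ** (hadamard ** B ** hadamard)" for A B
  proof -
    have "(hadamard ** A ** hadamard) ** (hadamard ** B ** hadamard) = hadamard ** A ** (hadamard ** hadamard) ** B ** hadamard"
      by (simp only: matrix_mul_assoc)
    then show ?thesis
      by (simp add: hadamard_mult matrix_mul_assoc)
  qed
  have sx: "hadamard ** sigma_x ** hadamard = sigma_z" and sz: "hadamard ** sigma_z ** hadamard = sigma_x"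
    unfolding hadamard_mult(3,4)[symmetric] matrix_mul_assoc[symmetric] by (simp_all add: hadamard_mult)
  \<comment> \<open>The image is \<open>- sigma_y\<close>, written as a product of generators so
    that it is visibly in \<open>pauli_group\<close>.\<close>
  have y: "hadamard ** sigma_y ** hadamard = sigma_x ** sigma_y ** sigma_x"
    using half_sqrt2
    by (simp add: vec_eq_iff matrix_mult_bool hadamard_def all_bool_eq sigma_x_def sigma_y_def)
  have conj: "hadamard ** g ** hadamard \<in> pauli_group" if "g \<in> pauli_group" for g
    using that by induction (auto simp: mul sx sz y hadamard_mult intro: pauli_group.intros)
  moreover have "g = hadamard ** (hadamard ** g ** hadamard) ** hadamard" for g
  proof -
    have "hadamard ** (hadamard ** g ** hadamard) ** hadamard = (hadamard ** hadamard) ** g ** (hadamard ** hadamard)"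
      by (simp only: matrix_mul_assoc)
    then show ?thesis
      by (simp add: hadamard_mult)
  qed
  ultimately have "(\<lambda>g. hadamard ** g ** hadamard) ` pauli_group = pauli_group"
    by blast
  then show ?thesis
    by (simp add: clifford_group_def unitary_op_def hadamard_mult)
qed

lemma id_clifford: "mat 1 \<in> clifford_group"
proof -
  have "conj_transpose (mat 1) = mat 1"
    by (auto simp: vec_eq_iff conj_transpose_def mat_def)
  then show ?thesis
    by (simp add: clifford_group_def unitary_op_def)
qed

section \<open>Graph states in the local Clifford orbit\<close>

text \<open>The generator of the graph state at \<open>v\<close>, pulled back along the local Clifford operator, is a Pauli
  operator that stabilizes \<open>\<psi>\<close>: at \<open>v\<close> it is the pulled back \<open>\<sigma>\<^sup>x\<close> with symplectic bits \<open>(ax v, az v)\<close>,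
  at a neighbour \<open>w\<close> the pulled back \<open>\<sigma>\<^sup>z\<close> with bits \<open>(bx w, bz w)\<close>. It commutes with every other
  Pauli stabilizer of \<open>\<psi>\<close>, whatever its phase.\<close>

lemma pulled_back_generators:
  assumes "finite Q" "state Q \<psi>" "simple_graph Q G" "graph_state Q G \<phi>" "lc_equivalent Q \<psi> \<phi>"
  obtains ax az bx bz where
    "\<And>v. v \<in> Q \<Longrightarrow> (ax v \<and> bz v) \<noteq> (az v \<and> bx v)"
    "\<And>v A. v \<in> Q \<Longrightarrow> prod_op Q A sigma_x \<psi> = \<psi> \<Longrightarrow>
       even (card {w\<in>Q. w \<in> A \<and> (if w = v then az v else (v, w) \<in> G \<and> bz w)})"
    "\<And>v A. v \<in> Q \<Longrightarrow> prod_op Q A sigma_z \<psi> = \<psi> \<Longrightarrow>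
       even (card {w\<in>Q. w \<in> A \<and> (if w = v then ax v else (v, w) \<in> G \<and> bx w)})"
proof -
  obtain U where U: "\<And>i. i \<in> Q \<Longrightarrow> U i \<in> clifford_group" and \<phi>: "\<phi> = tensor_op Q U \<psi>"
    using assms(5) unfolding lc_equivalent_def by blast
  have "\<forall>i. \<exists>c ax az d bx bz. i \<in> Q \<longrightarrow> conj_transpose (U i) ** sigma_x ** U i = weyl c ax az \<and>
    conj_transpose (U i) ** sigma_z ** U i = weyl d bx bz \<and> (ax \<and> bz) \<noteq> (az \<and> bx)"
    using clifford_conj_weyl[OF U] by metis
  then obtain c ax az d bx bz where w: "\<And>i. i \<in> Q \<Longrightarrow>
     conj_transpose (U i) ** sigma_x ** U i = weyl (c i) (ax i) (az i)"
    "\<And>i. i \<in> Q \<Longrightarrow> conj_transpose (U i) ** sigma_z ** U i = weyl (d i) (bx i) (bz i)"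
    "\<And>i. i \<in> Q \<Longrightarrow> (ax i \<and> bz i) \<noteq> (az i \<and> bx i)"
    by metis
  define g where "g v i = (if i = v then weyl (c i) (ax i) (az i)
    else if (v, i) \<in> G then weyl (d i) (bx i) (bz i) else weyl 1 False False)" for v i
  have unit: "conj_transpose (U i) ** U i = mat 1" if "i \<in> Q" for i
    using U[OF that] by (simp add: clifford_group_def unitary_op_def)
  have g: "tensor_op Q (g v) \<psi> = \<psi>" if "v \<in> Q" for v
  proof -
    let ?M = "\<lambda>i. (if i \<in> {v} then sigma_x else mat 1) ** (if i \<in> G `` {v} then sigma_z else mat 1)"
    have "tensor_op Q ?M (tensor_op Q U \<psi>) = tensor_op Q U \<psi>"
      using assms(4) that
      by (simp add: graph_state_def prod_op_def tensor_op_comp[OF assms(1)] \<phi> matrix_mul_assoc)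
    then have "tensor_op Q (\<lambda>i. conj_transpose (U i)) (tensor_op Q ?M (tensor_op Q U \<psi>))
        = tensor_op Q (\<lambda>i. conj_transpose (U i)) (tensor_op Q U \<psi>)"
      by simp
    then have "tensor_op Q (\<lambda>i. conj_transpose (U i) ** (?M i ** U i)) \<psi>
        = tensor_op Q (\<lambda>i. conj_transpose (U i) ** U i) \<psi>"
      by (simp only: tensor_op_comp[OF assms(1)])
    moreover have "tensor_op Q (\<lambda>i. conj_transpose (U i) ** U i) \<psi> = tensor_op Q (\<lambda>i. mat 1) \<psi>"
      by (intro fun_cong[OF tensor_op_cong] unit)
    moreover have "tensor_op Q (\<lambda>i. mat 1) \<psi> = \<psi>"
      using assms(1,2) by (intro tensor_op_id) (auto simp: state_def)
    moreover have "tensor_op Q (\<lambda>i. conj_transpose (U i) ** (?M i ** U i)) \<psi> = tensor_op Q (g v) \<psi>"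
    proof (intro fun_cong[OF tensor_op_cong])
      fix i
      assume "i \<in> Q"
      moreover have "(v, v) \<notin> G"
        using assms(3) by (simp add: simple_graph_def irrefl_def)
      ultimately show "conj_transpose (U i) ** (?M i ** U i) = g v i"
        using w(1,2)[of i] unit[of i]
        by (auto simp: g_def matrix_mul_assoc sigma_eq_weyl(1)[symmetric])
    qed
    ultimately show ?thesis
      by simp
  qed
  show ?thesis
  proof (rule that)
    fix v A
    assume v: "v \<in> Q" and A: "prod_op Q A sigma_x \<psi> = \<psi>"
    \<comment> \<open>Against \<open>sigma_x\<close> the z bit of \<open>g v\<close> at a site
      decides the sign, against \<open>sigma_z\<close> below the x bit.\<close>
    have "even (card {i\<in>Q. i \<in> A \<and> (if i = v then az v else (v, i) \<in> G \<and> bz i)})"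
      by (rule even_anticommuting_sites[OF assms(1,2) g[OF v] A[unfolded prod_op_def]])
        (auto simp: g_def sigma_eq_weyl weyl_mult weyl_uminus)
    then show "even (card {w\<in>Q. w \<in> A \<and> (if w = v then az v else (v, w) \<in> G \<and> bz w)})"
      by simp
  next
    fix v A
    assume v: "v \<in> Q" and A: "prod_op Q A sigma_z \<psi> = \<psi>"
    have "even (card {i\<in>Q. i \<in> A \<and> (if i = v then ax v else (v, i) \<in> G \<and> bx i)})"
      by (rule even_anticommuting_sites[OF assms(1,2) g[OF v] A[unfolded prod_op_def]])
        (auto simp: g_def sigma_eq_weyl weyl_mult weyl_uminus)
    then show "even (card {w\<in>Q. w \<in> A \<and> (if w = v then ax v else (v, w) \<in> G \<and> bx w)})"
      by simp
  qed (use w(3) in blast)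
qed

section \<open>No local graph state for the plus-shaped pentomino\<close>

text \<open>The arms are numbered clockwise modulo 4. In arm \<open>i\<close>, \<open>e i\<close> is the side shared with the central
  square, \<open>out i\<close> the side opposite to it, and \<open>l i\<close> and \<open>r i\<close> are the left and right sides seen from
  the centre. \<open>X v\<close> and \<open>Z v\<close> are the \<open>\<sigma>\<^sup>x\<close> and \<open>\<sigma>\<^sup>z\<close> parts of the pulled back generator at \<open>v\<close>.\<close>

locale plus_generators =
  fixes e out l r :: "nat \<Rightarrow> 'q" and Q :: "'q set" and X Z N :: "'q \<Rightarrow> 'q \<Rightarrow> bool" and bx bz :: "'q \<Rightarrow> bool"
  assumes period: "e (i + 4) = e i" "out (i + 4) = out i" "l (i + 4) = l i" "r (i + 4) = r i"
    and in_Q: "e i \<in> Q" "out i \<in> Q" "l i \<in> Q" "r i \<in> Q"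
    and neq: "e i \<noteq> out j" "e i \<noteq> l j" "e i \<noteq> r j" "out i \<noteq> l j" "out i \<noteq> r j" "l i \<noteq> r j"
      "e i \<noteq> e (i + 1)" "e i \<noteq> e (i + 2)" "e i \<noteq> e (i + 3)"
      "out i \<noteq> out (i + 1)" "out i \<noteq> out (i + 2)" "out i \<noteq> out (i + 3)"
    and off_diag: "v \<noteq> w \<Longrightarrow> X v w \<longleftrightarrow> N v w \<and> bx w" "v \<noteq> w \<Longrightarrow> Z v w \<longleftrightarrow> N v w \<and> bz w"
    and diag: "v \<in> Q \<Longrightarrow> (X v v \<and> bz v) \<noteq> (Z v v \<and> bx v)"
    and sym: "N v w \<longleftrightarrow> N w v"
    and star_out: "v \<in> Q \<Longrightarrow> Z v (l i) = Z v (out i)" "v \<in> Q \<Longrightarrow> Z v (r i) = Z v (out i)"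
    and star_in: "v \<in> Q \<Longrightarrow> (Z v (e i) \<noteq> Z v (e (i + 1))) = (Z v (r i) \<noteq> Z v (l (i + 1)))"
    and plaq_arm: "v \<in> Q \<Longrightarrow> (X v (e i) \<noteq> X v (out i)) = (X v (l i) \<noteq> X v (r i))"
    and plaq_centre: "v \<in> Q \<Longrightarrow> (X v (e i) \<noteq> X v (e (i + 1))) = (X v (e (i + 2)) \<noteq> X v (e (i + 3)))"
    and local_out: "k \<in> {1, 2, 3} \<Longrightarrow> \<not> N (out i) (e (i + k))" "k \<in> {1, 2, 3} \<Longrightarrow> \<not> N (out i) (out (i + k))"
    and local_e: "k \<in> {1, 2, 3} \<Longrightarrow> \<not> N (e i) (out (i + k))"
      "k \<in> {2, 3} \<Longrightarrow> \<not> N (e i) (l (i + k))" "k \<in> {1, 2} \<Longrightarrow> \<not> N (e i) (r (i + k))"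
begin

\<comment> \<open>keeps the offsets \<open>i + k\<close> as numerals\<close>
declare One_nat_def [simp del] add_2_eq_Suc [simp del] add_2_eq_Suc' [simp del]

text \<open>By \<open>diag\<close> the generator at \<open>l i\<close> would have a Z part at
  \<open>l i\<close>. The two outer corners of the arm carry it over \<open>out i\<close> to
  \<open>r i\<close>, where the pulled back \<open>sigma_z\<close> has no Z part.\<close>

lemma arm_not_both_x: "\<not> (bx (l i) \<and> \<not> bz (l i) \<and> bx (r i) \<and> \<not> bz (r i))"
proof
  assume *: "bx (l i) \<and> \<not> bz (l i) \<and> bx (r i) \<and> \<not> bz (r i)"
  then have "Z (l i) (l i)"
    using diag[OF in_Q(3)] by blast
  then have "Z (l i) (r i)"
    using star_out[OF in_Q(3)] by simp
  then show False
    using * off_diag(2)[OF neq(6)] by blast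
qed

text \<open>Locality keeps the generator at \<open>e i\<close> off the other three sides of the
  opposite arm, so the plaquette of that arm excludes an X part at \<open>e (i + 2)\<close> as
  well.\<close>

lemma opposite_adj_bits:
  assumes "N (e i) (e (i + 2))"
  shows "\<not> bx (e (i + 2))" "bz (e (i + 2))"
proof -
  have "\<not> X (e i) (out (i + 2))" "\<not> X (e i) (l (i + 2))" "\<not> X (e i) (r (i + 2))"
    using local_e[of 2 i] by (simp_all add: off_diag(1) neq)
  then have "\<not> X (e i) (e (i + 2))"
    using plaq_arm[OF in_Q(1), of i "i + 2"] by simp
  then show "\<not> bx (e (i + 2))"
    using assms by (simp add: off_diag(1) neq)
  then show "bz (e (i + 2))"
    using diag[OF in_Q(1)] by blast
qed

text \<open>Follow the generator at \<open>e i\<close>: the inner corners carry its Z part from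
  \<open>e (i + 2)\<close> to both neighbouring arms, and the central plaquette gives an X part to
  exactly one of their inner sides. The plaquette of that arm needs a second X part, for which
  locality leaves only the side next to arm \<open>i\<close>; there the outer corner excludes a Z
  part.\<close>

lemma opposite_adj_row:
  assumes "N (e i) (e (i + 2))"
  shows "N (e i) (e (i + 1))" "N (e i) (e (i + 3))" "bx (e (i + 1)) \<noteq> bx (e (i + 3))"
    "bx (e (i + 1)) \<Longrightarrow> bx (l (i + 1)) \<and> \<not> bz (l (i + 1))"
    "bx (e (i + 3)) \<Longrightarrow> bx (r (i + 3)) \<and> \<not> bz (r (i + 3))"
proof -
  \<comment> \<open>Arm \<open>i + 2 + 2\<close> is arm \<open>i\<close>, so the bits of
    \<open>e i\<close> can be read off from the opposite arm.\<close>
  have adj': "N (e (i + 2)) (e (i + 2 + 2))"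
    using assms period(1)[of i] by (simp add: sym add.assoc)
  have "\<not> bx (e i)"
    using opposite_adj_bits(1)[OF adj'] period(1)[of i] by (simp add: add.assoc)
  then have Xii: "X (e i) (e i)"
    using diag[OF in_Q(1)] by blast
  have out0: "\<not> Z (e i) (out (i + k)) \<and> \<not> X (e i) (out (i + k))" if "k \<in> {1, 2, 3}" for k
    using local_e(1)[OF that] by (simp add: off_diag neq)
  have r0: "\<not> Z (e i) (r (i + k)) \<and> \<not> X (e i) (r (i + k))" if "k \<in> {1, 2}" for k
    using local_e(3)[OF that] by (simp add: off_diag neq)
  have l0: "\<not> Z (e i) (l (i + k)) \<and> \<not> X (e i) (l (i + k))" if "k \<in> {2, 3}" for k
    using local_e(2)[OF that] by (simp add: off_diag neq)
  have Z1: "\<not> Z (e i) (l (i + 1))" and Z3: "\<not> Z (e i) (r (i + 3))"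
    using star_out[OF in_Q(1), of i] out0 by simp_all
  have Z2: "Z (e i) (e (i + 2))" and X2: "\<not> X (e i) (e (i + 2))"
    using assms opposite_adj_bits[OF assms] by (simp_all add: off_diag neq)
  have Ze: "Z (e i) (e (i + 1))" "Z (e i) (e (i + 3))"
    using Z2 r0[of 1] r0[of 2] l0[of 2] l0[of 3]
      star_in[OF in_Q(1), of i "i + 1"] star_in[OF in_Q(1), of i "i + 2"]
    by (simp_all add: add.assoc)
  then show N1: "N (e i) (e (i + 1))" and N3: "N (e i) (e (i + 3))"
    by (simp_all add: off_diag neq)
  show "bx (e (i + 1)) \<noteq> bx (e (i + 3))"
    using plaq_centre[OF in_Q(1), of i i] Xii X2 N1 N3 by (auto simp: off_diag neq)
  have "X (e i) (e (i + 1)) = X (e i) (l (i + 1))"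
    using plaq_arm[OF in_Q(1), of i "i + 1"] out0[of 1] r0[of 1] by simp
  then show "bx (e (i + 1)) \<Longrightarrow> bx (l (i + 1)) \<and> \<not> bz (l (i + 1))"
    using N1 Z1 by (auto simp: off_diag neq)
  have "X (e i) (e (i + 3)) = X (e i) (r (i + 3))"
    using plaq_arm[OF in_Q(1), of i "i + 3"] out0[of 3] l0[of 3] by simp
  then show "bx (e (i + 3)) \<Longrightarrow> bx (r (i + 3)) \<and> \<not> bz (r (i + 3))"
    using N3 Z3 by (auto simp: off_diag neq)
qed

text \<open>Exactly one of the arms \<open>i + 1\<close> and \<open>i + 3\<close> has the x bit at
  its inner side. Viewed from \<open>e i\<close> and from \<open>e (i + 2)\<close>, that arm gets
  the bits of \<open>sigma_x\<close> on both its left and its right side, which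
  \<open>arm_not_both_x\<close> excludes.\<close>

lemma opposite_not_adj: "\<not> N (e i) (e (i + 2))"
proof
  assume adj: "N (e i) (e (i + 2))"
  then have adj': "N (e (i + 2)) (e (i + 2 + 2))"
    using period(1)[of i] by (simp add: sym add.assoc)
  have per5: "e (i + 5) = e (i + 1)" "r (i + 5) = r (i + 1)"
    using period(1,4)[of "i + 1"] by (simp_all add: add.assoc)
  show False
    using opposite_adj_row[OF adj] opposite_adj_row[OF adj'] arm_not_both_x[of "i + 1"] arm_not_both_x[of "i + 3"]
    by (auto simp: add.assoc per5)
qed

text \<open>At the inner corner between consecutive arms, the outer corners allow \<open>r\<close>
  and \<open>l\<close> to be replaced by \<open>out\<close>. So the parity of the Z part on the pair
  \<open>out\<close>, \<open>e\<close> is the same for all arms.\<close>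

lemma pair_parity_shift: "v \<in> Q \<Longrightarrow> (Z v (out i) = Z v (e i)) = (Z v (out (i + k)) = Z v (e (i + k)))"
proof (induction k)
  case (Suc k)
  then show ?case
    using star_in[of v "i + k"] star_out[of v "i + k"] star_out[of v "i + k + 1"]
    by (auto simp: Suc_eq_plus1 add.assoc)
qed simp

text \<open>Without adjacent opposite arms, \<open>X (out i) X (e i)\<close> commutes with all the generators that matter
  here, so it would have to be a product of generators, although it anticommutes with the central
  plaquette.\<close>

lemma contradiction: False
proof -
  define i :: nat where "i = 0"
  \<comment> \<open>Each of these generators has no Z part on \<open>out\<close> and
    \<open>e\<close> of the arm opposite to its own: offset 2 for \<open>out i\<close> and
    \<open>e i\<close>, 3 for \<open>e (i + 1)\<close>, and 5, which is arm \<open>i + 1\<close>,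
    for \<open>e (i + 3)\<close>.\<close>
  have pair: "Z v (out i) = Z v (e i)" if "v \<in> {out i, e i, e (i + 1), e (i + 3)}" for v
  proof -
    have "v \<in> Q" "\<exists>k. \<not> Z v (out (i + k)) \<and> \<not> Z v (e (i + k))"
      using that
    proof safe
      show "\<exists>k. \<not> Z (out i) (out (i + k)) \<and> \<not> Z (out i) (e (i + k))"
        using local_out[of 2 i] neq(1)[symmetric] by (intro exI[of _ 2]) (simp add: off_diag neq)
      show "\<exists>k. \<not> Z (e i) (out (i + k)) \<and> \<not> Z (e i) (e (i + k))"
        using local_e(1)[of 2 i] opposite_not_adj by (intro exI[of _ 2]) (simp add: off_diag neq)
      show "\<exists>k. \<not> Z (e (i + 1)) (out (i + k)) \<and> \<not> Z (e (i + 1)) (e (i + k))"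
        using local_e(1)[of 2 "i + 1"] opposite_not_adj[of "i + 1"] neq(8)[of "i + 1"]
        by (intro exI[of _ 3]) (simp add: off_diag neq add.assoc)
      show "\<exists>k. \<not> Z (e (i + 3)) (out (i + k)) \<and> \<not> Z (e (i + 3)) (e (i + k))"
        using local_e(1)[of 2 "i + 3"] opposite_not_adj[of "i + 3"] neq(8)[of "i + 3"]
        by (intro exI[of _ 5]) (simp add: off_diag neq add.assoc)
    qed (use in_Q in auto)
    then show ?thesis
      using pair_parity_shift[of v i] by blast
  qed
  let ?o = "out i" and ?e = "e i"
  have ne: "?o \<noteq> ?e" "?e \<noteq> ?o"
    using neq(1)[of i i] by auto
  have o_far: "\<not> X ?o (e (i + k))" if "k \<in> {1, 2, 3}" for k
    using local_out(1)[OF that] neq(1)[symmetric] by (simp add: off_diag)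
  \<comment> \<open>The other three inner sides carry no X part, so the central plaquette excludes
    one on the fourth.\<close>
  have oe: "\<not> X ?o ?e"
    using plaq_centre[OF in_Q(2), of i i] o_far by simp
  have e_opp: "\<not> X ?e (e (i + 2))"
    using opposite_not_adj by (simp add: off_diag neq)
  have far: "N ?e w \<Longrightarrow> bz ?e = bz ?o \<and> N ?o w \<or> \<not> bz ?e" if "w \<in> {e (i + 1), e (i + 3)}" for w
  proof -
    assume N: "N ?e w"
    have "w \<noteq> ?e" "w \<noteq> ?o"
      using that by (auto simp: neq neq[symmetric])
    then show ?thesis
      using N pair[of w] that sym[of w] by (auto simp: off_diag)
  qed
  have no_far: "\<not> N ?o w" if "w \<in> {e (i + 1), e (i + 3)}" for w
    using that local_out(1)[of _ i] by auto
  \<comment> \<open>Otherwise the Z part at \<open>?e\<close> spreads to \<open>?o\<close> by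
    \<open>pair\<close>, so the two are adjacent. As the x bit of \<open>?e\<close> is set, the
    generator at \<open>?o\<close> has an X part at \<open>?e\<close>, against
    \<open>oe\<close>.\<close>
  have "bz ?e"
  proof (rule ccontr)
    assume "\<not> bz ?e"
    then have "bx ?e" "Z ?e ?e"
      using diag[OF in_Q(1), of i] by auto
    then have "N ?e ?o"
      using pair[of ?e] ne by (auto simp: off_diag)
    then show False
      using oe \<open>bx ?e\<close> ne sym by (simp add: off_diag)
  qed
  then have "\<not> N ?e (e (i + 1))" "\<not> N ?e (e (i + 3))"
    using far no_far by blast+
  \<comment> \<open>Now \<open>?e\<close> is adjacent to no other inner side, so the central
    plaquette clears the diagonal entry and the argument for \<open>bz ?e\<close> repeats.\<close>
  then have "\<not> X ?e ?e"
    using plaq_centre[OF in_Q(1), of i i] e_opp by (simp add: off_diag neq)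
  then have "bx ?e" "Z ?e ?e"
    using diag[OF in_Q(1), of i] by auto
  then have "N ?e ?o"
    using pair[of ?e] ne by (auto simp: off_diag)
  then show False
    using oe \<open>bx ?e\<close> ne sym by (simp add: off_diag)
qed

end

section \<open>Small polyominoes\<close>

lemma side_eq:
  fixes x y a b :: int
  shows "{(x, y), (x + 1, y)} = {(a, b), (a + 1, b)} \<longleftrightarrow> a = x \<and> b = y"
    "{(x, y), (x, y + 1)} = {(a, b), (a, b + 1)} \<longleftrightarrow> a = x \<and> b = y"
    "{(x, y), (x + 1, y)} \<noteq> {(a, b), (a, b + 1)}"
  by (auto simp: doubleton_eq_iff)

lemma mem_sides:
  "{(x, y), (x + 1, y)} \<in> sides q \<longleftrightarrow> q = (x, y) \<or> q = (x, y - 1)"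
  "{(x, y), (x, y + 1)} \<in> sides q \<longleftrightarrow> q = (x, y) \<or> q = (x - 1, y)"
  by (cases q, simp only: sides.simps insert_iff empty_iff side_eq side_eq(3)[symmetric] prod.inject eq_diff_eq
   simp_thms)+

lemma mem_qubits:
  "{(x, y), (x + 1, y)} \<in> qubits Q \<longleftrightarrow> (x, y) \<in> Q \<or> (x, y - 1) \<in> Q"
  "{(x, y), (x, y + 1)} \<in> qubits Q \<longleftrightarrow> (x, y) \<in> Q \<or> (x - 1, y) \<in> Q"
  by (auto simp: qubits_def mem_sides)

lemma mem_verts:
  "(x, y) \<in> verts Q \<longleftrightarrow> (x, y) \<in> Q \<or> (x - 1, y) \<in> Q \<or> (x, y - 1) \<in> Q \<or> (x - 1, y - 1) \<in> Q"
proof -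
  have corners: "(x, y) \<in> corners q \<longleftrightarrow> q = (x, y) \<or> q = (x - 1, y) \<or> q = (x, y - 1) \<or> q = (x - 1, y - 1)" for q
    by (cases q) (simp add: eq_diff_eq eq_commute[of x] eq_commute[of y])
  then show ?thesis
    unfolding verts_def UN_iff by (simp only: corners) blast
qed

lemma finite_qubits: "finite P \<Longrightarrow> finite (qubits P)"
  by (auto simp: qubits_def)

lemma finite_verts: "finite P \<Longrightarrow> finite (verts P)"
  by (auto simp: verts_def)

lemma qubit_subset_verts: "e \<in> qubits P \<Longrightarrow> e \<subseteq> verts P"
proof -
  have "e \<subseteq> corners p" if "e \<in> sides p" for p
    using that by (cases p) auto
  then show "e \<in> qubits P \<Longrightarrow> e \<subseteq> verts P"
    unfolding qubits_def verts_def by blast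
qed

lemma finite_qubit: "e \<in> qubits P \<Longrightarrow> finite e"
  by (auto simp: qubits_def)

text \<open>Every cell owns its bottom side, every column moreover a topmost side; similarly for the
  vertical sides.\<close>

lemma card_qubits_ge:
  assumes "finite P"
  shows "2 * card P + card (fst ` P) + card (snd ` P) \<le> card (qubits P)"
proof -
  define top where "top a = Max {b. (a, b) \<in> P}" for a
  define right where "right b = Max {a. (a, b) \<in> P}" for b
  have fin: "finite {b. (a, b) \<in> P}" "finite {a. (a, b) \<in> P}" for a b
    by (rule finite_subset[of _ "snd ` P"], force, use assms in simp,
        rule finite_subset[of _ "fst ` P"], force, use assms in simp)
  have top: "(a, top a) \<in> P" "b \<le> top a" if "(a, b) \<in> P" for a b
    using that Max_in[OF fin(1)] Max_ge[OF fin(1)] unfolding top_def by blast+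
  have right: "(right b, b) \<in> P" "a \<le> right b" if "(a, b) \<in> P" for a b
    using that Max_in[OF fin(2)] Max_ge[OF fin(2)] unfolding right_def by blast+
  define H where "H = (\<lambda>(a, b). {(a, b), (a + 1, b)}) ` P"
  define H' where "H' = (\<lambda>a. {(a, top a + 1), (a + 1, top a + 1)}) ` fst ` P"
  define V where "V = (\<lambda>(a, b). {(a, b), (a, b + 1)}) ` P"
  define V' where "V' = (\<lambda>b. {(right b + 1, b), (right b + 1, b + 1)}) ` snd ` P"
  have card: "card H = card P" "card H' = card (fst ` P)" "card V = card P" "card V' = card (snd ` P)"
    unfolding H_def H'_def V_def V'_def
    by (intro card_image; auto simp: inj_on_def side_eq)+
  \<comment> \<open>A top side in \<open>H'\<close> that is also a bottom side would belong to a
    cell above the topmost one of its column; the rows are similar.\<close>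
  have disj: "H \<inter> H' = {}" "(H \<union> H') \<inter> V = {}" "(H \<union> H' \<union> V) \<inter> V' = {}"
    unfolding H_def H'_def V_def V'_def using top(2) right(2) by (fastforce simp: doubleton_eq_iff)+
  have fin: "finite H" "finite H'" "finite V" "finite V'"
    using assms by (simp_all add: H_def H'_def V_def V'_def)
  have "H \<union> H' \<union> V \<union> V' \<subseteq> qubits P"
    using top(1) right(1) by (auto simp: H_def H'_def V_def V'_def mem_qubits)
  then have "card (H \<union> H' \<union> V \<union> V') \<le> card (qubits P)"
    by (intro card_mono finite_qubits assms)
  moreover have "card (H \<union> H' \<union> V \<union> V') = 2 * card P + card (fst ` P) + card (snd ` P)"
    using fin disj by (simp add: card_Un_disjoint card)
  ultimately show ?thesis
    by simp
qed

text \<open>A side is shared with at most one neighbour, so a missing neighbour leaves the side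
  towards it private.\<close>

lemma ex_private_side:
  assumes "(a, b + 1) \<notin> P \<or> (a + 1, b) \<notin> P \<or> (a, b - 1) \<notin> P \<or> (a - 1, b) \<notin> P"
  shows "\<exists>e\<in>sides (a, b). \<forall>q\<in>P. e \<in> sides q \<longrightarrow> q = (a, b)"
  using assms mem_sides(1)[of a b] mem_sides(1)[of a "b + 1"] mem_sides(2)[of a b] mem_sides(2)[of "a + 1" b]
  by auto

text \<open>With \<open>n\<close> cells in \<open>c\<close> columns and \<open>r\<close> rows,
  \<open>n\<close> is at most \<open>c r\<close> and there are at least \<open>2 n + c + r\<close>
  qubits. Six cells with fewer than 16 qubits would need \<open>c + r < 4\<close>, hence
  \<open>c r \<le> 2\<close>. A cell with four neighbours forces \<open>n \<ge> 5\<close>,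
  \<open>c \<ge> 3\<close> and \<open>r \<ge> 3\<close>, hence at least 16 qubits.\<close>

lemma small_polyomino:
  assumes "finite P" "card P < 5 \<or> card (qubits P) < 16"
  shows "card P \<le> 5" "p \<in> P \<Longrightarrow> \<exists>e\<in>sides p. \<forall>q\<in>P. e \<in> sides q \<longrightarrow> q = p"
proof -
  have "card P \<le> card (fst ` P \<times> snd ` P)"
    using assms(1) by (intro card_mono) force+
  then have prod: "card P \<le> card (fst ` P) * card (snd ` P)"
    by (simp add: card_cartesian_product)
  note E = card_qubits_ge[OF assms(1)]
  show "card P \<le> 5"
  proof (rule ccontr)
    assume "\<not> card P \<le> 5"
    then have "card (fst ` P) + card (snd ` P) < 4" "card (fst ` P) * card (snd ` P) \<ge> 6"
      using assms(2) E prod by linarith+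
    then have "card (fst ` P) \<le> 3" "card (snd ` P) \<le> 3 - card (fst ` P)"
      by linarith+
    then have "card (fst ` P) * card (snd ` P) \<le> card (fst ` P) * (3 - card (fst ` P))" "card (fst ` P) \<in> {0, 1, 2, 3}"
      by auto
    then show False
      using \<open>6 \<le> _\<close> by auto
  qed
  show "\<exists>e\<in>sides p. \<forall>q\<in>P. e \<in> sides q \<longrightarrow> q = p" if "p \<in> P"
  proof (rule ccontr)
    assume none: "\<not> ?thesis"
    obtain a b where p: "p = (a, b)"
      by (cases p)
    have sub: "{(a, b), (a, b + 1), (a + 1, b), (a, b - 1), (a - 1, b)} \<subseteq> P"
      using ex_private_side[of a b P] none that p by auto
    have "card {(a, b), (a, b + 1), (a + 1, b), (a, b - 1), (a - 1, b)} = 5"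
      by simp
    then have "5 \<le> card P"
      using card_mono[OF assms(1) sub] by simp
    moreover have "card {a - 1, a, a + 1} \<le> card (fst ` P)" "card {b - 1, b, b + 1} \<le> card (snd ` P)"
      using sub by (intro card_mono; use assms(1) in force)+
    ultimately show False
      using E assms(2) by simp
  qed
qed

section \<open>Connectivity of polyominoes with few cells\<close>

lemma polyomino_boundary:
  assumes "polyomino Q" "B \<subseteq> Q" "B \<noteq> {}" "B \<noteq> Q"
  obtains x y where "x \<in> B" "y \<in> Q - B" "cell_adj x y"
proof -
  obtain b q where bq: "b \<in> B" "q \<in> Q - B"
    using assms by blast
  then have "(b, q) \<in> {(x, y). x \<in> Q \<and> y \<in> Q \<and> cell_adj x y}\<^sup>*"
    using assms(1,2) unfolding polyomino_def by blast
  then have "q \<in> B \<or> (\<exists>x\<in>B. \<exists>y\<in>Q - B. cell_adj x y)"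
    by (induction rule: rtrancl_induct) (use bq in auto)
  then show ?thesis
    using bq that by blast
qed

lemma cell_adj_sym: "cell_adj p q \<Longrightarrow> cell_adj q p"
  by (simp add: cell_adj_def abs_minus_commute)

lemma polyomino_insert:
  assumes "polyomino Q" "x \<in> Q" "cell_adj x y"
  shows "polyomino (insert y Q)"
proof -
  let ?R = "\<lambda>Q. {(u, v). u \<in> Q \<and> v \<in> Q \<and> cell_adj u v}"
  have "?R Q \<subseteq> ?R (insert y Q)"
    by blast
  then have "(?R Q)\<^sup>* \<subseteq> (?R (insert y Q))\<^sup>*"
    by (rule rtrancl_mono)
  then have old: "(u, v) \<in> (?R (insert y Q))\<^sup>*" if "u \<in> Q" "v \<in> Q" for u v
    using assms(1) that unfolding polyomino_def by blast
  have "(x, y) \<in> (?R (insert y Q))\<^sup>*" "(y, x) \<in> (?R (insert y Q))\<^sup>*"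
    using assms(2,3) cell_adj_sym by blast+
  then have "(u, x) \<in> (?R (insert y Q))\<^sup>*" "(x, u) \<in> (?R (insert y Q))\<^sup>*" if "u \<in> insert y Q" for u
    using that old assms(2) by blast+
  then have "(u, v) \<in> (?R (insert y Q))\<^sup>*" if "u \<in> insert y Q" "v \<in> insert y Q" for u v
    using that rtrancl_trans by meson
  then show ?thesis
    using assms(1) by (simp add: polyomino_def)
qed

abbreviation (input) steps :: "(int \<times> int) set" where
  "steps \<equiv> {(0, 0), (1, 0), (-1, 0), (0, 1), (0, -1)}"

text \<open>The set of cells reached from the start gains a cell at each step until it is all of
  \<open>Q\<close>, so among at most four cells three steps suffice. The intermediate cells are
  \<open>x\<close> and \<open>y\<close>; a step may stand still.\<close>

lemma polyomino_walk:
  assumes "polyomino Q" "card Q \<le> 4" "(u1, u2) \<in> Q" "(v1, v2) \<in> Q"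
  obtains x1 x2 y1 y2 where "(x1, x2) \<in> Q" "(y1, y2) \<in> Q"
    "(x1 - u1, x2 - u2) \<in> steps" "(y1 - v1, y2 - v2) \<in> steps" "\<bar>x1 - y1\<bar> + \<bar>x2 - y2\<bar> \<le> 1"
proof -
  have steps: "(i, j) \<in> steps" if "\<bar>i\<bar> + \<bar>j\<bar> \<le> 1" for i j :: int
  proof -
    have "i = 0 \<or> i = 1 \<or> i = -1" "j = 0 \<or> j = 1 \<or> j = -1"
      using that by arith+
    then show ?thesis
      using that by auto
  qed
  define nb where "nb B = {y\<in>Q. \<exists>x\<in>B. \<bar>fst x - fst y\<bar> + \<bar>snd x - snd y\<bar> \<le> 1}" for B
  have finQ: "finite Q"
    using assms(1) by (simp add: polyomino_def)
  have sub: "nb B \<subseteq> Q" for B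
    by (auto simp: nb_def)
  have incr: "B \<subseteq> nb B" if "B \<subseteq> Q" for B
    using that by (force simp: nb_def)
  have grow: "nb B = Q \<or> card B < card (nb B)" if B: "B \<subseteq> Q" "B \<noteq> {}" for B
  proof (cases "B = Q")
    case True
    then show ?thesis
      using incr[of Q] sub by blast
  next
    case False
    obtain x y where "x \<in> B" "y \<in> Q - B" "cell_adj x y"
      using polyomino_boundary[OF assms(1) B False] by blast
    then have "y \<in> nb B - B"
      by (force simp: nb_def cell_adj_def)
    then have "B \<subset> nb B"
      using incr[OF B(1)] by blast
    then show ?thesis
      using psubset_card_mono finite_subset[OF sub finQ] by blast
  qed
  have full: "nb (nb B) = Q" if "nb B = Q" for B
    using that incr[of "nb B"] sub by blast
  let ?B0 = "{(u1, u2)}"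
  have B0: "?B0 \<subseteq> Q" "?B0 \<noteq> {}"
    using assms(3) by auto
  then have ne: "nb ?B0 \<noteq> {}" "nb (nb ?B0) \<noteq> {}"
    using incr[OF B0(1)] incr[OF sub] by blast+
  have "nb (nb (nb ?B0)) = Q"
  proof (rule ccontr)
    assume *: "nb (nb (nb ?B0)) \<noteq> Q"
    then have "nb (nb ?B0) \<noteq> Q" "nb ?B0 \<noteq> Q"
      using full by blast+
    then have "card ?B0 < card (nb ?B0)" "card (nb ?B0) < card (nb (nb ?B0))"
        "card (nb (nb ?B0)) < card (nb (nb (nb ?B0)))"
      using grow[OF B0] grow[OF sub ne(1)] grow[OF sub ne(2)] * by blast+
    moreover have "card (nb (nb (nb ?B0))) < card Q"
      using * sub by (intro psubset_card_mono finQ) blast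
    ultimately show False
      using assms(2) by simp
  qed
  then have "(v1, v2) \<in> nb (nb (nb ?B0))"
    using assms(4) by simp
  then obtain x y where xy: "x \<in> Q" "y \<in> Q" "\<bar>u1 - fst x\<bar> + \<bar>u2 - snd x\<bar> \<le> 1"
    "\<bar>fst x - fst y\<bar> + \<bar>snd x - snd y\<bar> \<le> 1" "\<bar>fst y - v1\<bar> + \<bar>snd y - v2\<bar> \<le> 1"
    by (force simp: nb_def)
  show ?thesis
    by (rule that[of "fst x" "snd x" "fst y" "snd y"])
      (use xy steps[of "fst x - u1" "snd x - u2"] steps[of "fst y - v1" "snd y - v2"]
        in \<open>simp_all add: abs_minus_commute\<close>)
qed

text \<open>Coordinates are relative to a missing cell and \<open>d\<close> points to the start of
  the walk. The goal is the opposite cell \<open>- d\<close> or one of the two corner cells beside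
  it in the 3 by 3 block. Three steps must pass the centre or, for a corner goal, the cell at goal
  plus \<open>d\<close>; all cases are evaluated.\<close>

lemma short_walk:
  fixes d s t :: "int \<times> int"
  assumes "d \<in> {(0, 1), (1, 0), (0, -1), (-1, 0)}" "s \<in> steps" "t \<in> steps"
  shows
    "(\<bar>(fst d + fst s) - (- fst d + fst t)\<bar> + \<bar>(snd d + snd s) - (- snd d + snd t)\<bar> \<le> 1 \<longrightarrow>
       fst d + fst s = 0 \<and> snd d + snd s = 0 \<or> - fst d + fst t = 0 \<and> - snd d + snd t = 0) \<and>
     (\<bar>(fst d + fst s) - (- fst d - snd d + fst t)\<bar> + \<bar>(snd d + snd s) - (- snd d + fst d + snd t)\<bar> \<le> 1 \<longrightarrow>
       fst d + fst s = 0 \<and> snd d + snd s = 0 \<or> fst t = fst d \<and> snd t = snd d) \<and>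
     (\<bar>(fst d + fst s) - (- fst d + snd d + fst t)\<bar> + \<bar>(snd d + snd s) - (- snd d - fst d + snd t)\<bar> \<le> 1 \<longrightarrow>
       fst d + fst s = 0 \<and> snd d + snd s = 0 \<or> fst t = fst d \<and> snd t = snd d)"
    (is "?P d s t")
proof -
  have "\<forall>d\<in>{(0, 1), (1, 0), (0, -1), (-1, 0)}. \<forall>s\<in>steps. \<forall>t\<in>steps. ?P d s t"
    by code_simp
  then show ?thesis
    using assms by blast
qed

text \<open>A connected set of at most four cells is too short to get around a missing cell on both sides.\<close>

lemma around_cell:
  assumes "polyomino Q" "card Q \<le> 4" "(a, b) \<notin> Q" "(a + dx, b + dy) \<in> Q"
    and d: "(dx, dy) \<in> {(0, 1), (1, 0), (0, -1), (-1, 0)}"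
  shows "(a - dx, b - dy) \<notin> Q"
    and "(a - dx - dy, b - dy + dx) \<in> Q \<Longrightarrow> (a - dy, b + dx) \<in> Q"
    and "(a - dx + dy, b - dy - dx) \<in> Q \<Longrightarrow> (a + dy, b - dx) \<in> Q"
proof -
  show "(a - dx, b - dy) \<notin> Q"
  proof
    assume v: "(a - dx, b - dy) \<in> Q"
    obtain x1 x2 y1 y2 where w: "(x1, x2) \<in> Q" "(y1, y2) \<in> Q"
      "(x1 - (a + dx), x2 - (b + dy)) \<in> steps" "(y1 - (a - dx), y2 - (b - dy)) \<in> steps"
      "\<bar>x1 - y1\<bar> + \<bar>x2 - y2\<bar> \<le> 1"
      using polyomino_walk[OF assms(1,2,4) v] by blast
    have "(x1 = a \<and> x2 = b) \<or> (y1 = a \<and> y2 = b)"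
      using short_walk[OF d w(3,4), THEN conjunct1] w(5) by (simp add: algebra_simps)
    then show False
      using w assms(3) by blast
  qed
  show "(a - dy, b + dx) \<in> Q" if v: "(a - dx - dy, b - dy + dx) \<in> Q"
  proof -
    obtain x1 x2 y1 y2 where w: "(x1, x2) \<in> Q" "(y1, y2) \<in> Q"
      "(x1 - (a + dx), x2 - (b + dy)) \<in> steps" "(y1 - (a - dx - dy), y2 - (b - dy + dx)) \<in> steps"
      "\<bar>x1 - y1\<bar> + \<bar>x2 - y2\<bar> \<le> 1"
      using polyomino_walk[OF assms(1,2,4) v] by blast
    have "(x1 = a \<and> x2 = b) \<or> (y1 = a - dy \<and> y2 = b + dx)"
      using short_walk[OF d w(3,4), THEN conjunct2, THEN conjunct1] w(5) by (simp add: algebra_simps)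
    then show ?thesis
      using w assms(3) by blast
  qed
  show "(a + dy, b - dx) \<in> Q" if v: "(a - dx + dy, b - dy - dx) \<in> Q"
  proof -
    obtain x1 x2 y1 y2 where w: "(x1, x2) \<in> Q" "(y1, y2) \<in> Q"
      "(x1 - (a + dx), x2 - (b + dy)) \<in> steps" "(y1 - (a - dx + dy), y2 - (b - dy - dx)) \<in> steps"
      "\<bar>x1 - y1\<bar> + \<bar>x2 - y2\<bar> \<le> 1"
      using polyomino_walk[OF assms(1,2,4) v] by blast
    have "(x1 = a \<and> x2 = b) \<or> (y1 = a + dy \<and> y2 = b - dx)"
      using short_walk[OF d w(3,4), THEN conjunct2, THEN conjunct2] w(5) by (simp add: algebra_simps)
    then show ?thesis
      using w assms(3) by blast
  qed
qed

section \<open>Cuts\<close>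

text \<open>This expresses that the plaquettes generate the cycle space.\<close>

definition even_sets_are_cuts :: "cell set \<Rightarrow> bool" where
  "even_sets_are_cuts P \<longleftrightarrow> (\<forall>S. (\<forall>p\<in>P. even (card (S \<inter> sides p))) \<longrightarrow>
     (\<exists>U. \<forall>e\<in>qubits P. e \<in> S \<longleftrightarrow> odd (card (e \<inter> U))))"

lemma odd_card_pair: "u \<noteq> v \<Longrightarrow> odd (card ({u, v} \<inter> U)) \<longleftrightarrow> (u \<in> U) \<noteq> (v \<in> U)"
  by (simp add: Int_insert_left)

lemma even_card_four:
  "distinct [a, b, c, d] \<Longrightarrow>
    even (card (S \<inter> {a, b, c, d})) \<longleftrightarrow> (((a \<in> S) \<noteq> (b \<in> S)) = ((c \<in> S) \<noteq> (d \<in> S)))"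
  by (simp add: Int_insert_right)

text \<open>The cut is extended corner by corner from \<open>c0\<close>: an old corner comes with an
  old side, and a new one can be placed so that this side is right. The new corner \<open>c3\<close>
  is placed to suit \<open>{c3, c0}\<close>, and then \<open>{c2, c3}\<close> follows from the
  parity of the cell.\<close>

lemma even_sets_are_cuts_insert:
  assumes "even_sets_are_cuts Q" "distinct [c0, c1, c2, c3]"
    and sides: "sides p = {{c0, c1}, {c1, c2}, {c2, c3}, {c3, c0}}"
    and c1: "c1 \<in> verts Q \<Longrightarrow> {c0, c1} \<in> qubits Q"
    and c2: "c2 \<in> verts Q \<Longrightarrow> {c1, c2} \<in> qubits Q"
    and c3: "c3 \<notin> verts Q"
  shows "even_sets_are_cuts (insert p Q)"
  unfolding even_sets_are_cuts_def
proof (intro allI impI)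
  fix S
  assume even: "\<forall>q\<in>insert p Q. even (card (S \<inter> sides q))"
  then obtain U where U: "\<And>e. e \<in> qubits Q \<Longrightarrow> e \<in> S \<longleftrightarrow> odd (card (e \<inter> U))"
    using assms(1) unfolding even_sets_are_cuts_def by blast
  define t1 where "t1 = (if c1 \<in> verts Q then c1 \<in> U else (c0 \<in> U) \<noteq> ({c0, c1} \<in> S))"
  define t2 where "t2 = (if c2 \<in> verts Q then c2 \<in> U else t1 \<noteq> ({c1, c2} \<in> S))"
  define t3 where "t3 = ((c0 \<in> U) \<noteq> ({c3, c0} \<in> S))"
  define W where "W = {w. if w = c1 then t1 else if w = c2 then t2 else if w = c3 then t3 else w \<in> U}"
  have W: "c0 \<in> W \<longleftrightarrow> c0 \<in> U" "c1 \<in> W \<longleftrightarrow> t1" "c2 \<in> W \<longleftrightarrow> t2" "c3 \<in> W \<longleftrightarrow> t3"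
    using assms(2) by (auto simp: W_def)
  have "w \<in> W \<longleftrightarrow> w \<in> U" if "w \<in> verts Q" for w
    using that c3 by (auto simp: W_def t1_def t2_def)
  then have old: "e \<inter> W = e \<inter> U" if "e \<in> qubits Q" for e
    using qubit_subset_verts[OF that] by blast
  have ne: "c0 \<noteq> c1" "c1 \<noteq> c2" "c2 \<noteq> c3" "c3 \<noteq> c0"
    using assms(2) by auto
  have s1: "{c0, c1} \<in> S \<longleftrightarrow> odd (card ({c0, c1} \<inter> W))"
    using U[OF c1] old[OF c1] by (cases "c1 \<in> verts Q") (auto simp: odd_card_pair[OF ne(1)] W t1_def)
  have s2: "{c1, c2} \<in> S \<longleftrightarrow> odd (card ({c1, c2} \<inter> W))"
    using U[OF c2] old[OF c2] by (cases "c2 \<in> verts Q") (auto simp: odd_card_pair[OF ne(2)] W t2_def)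
  have s4: "{c3, c0} \<in> S \<longleftrightarrow> odd (card ({c3, c0} \<inter> W))"
    by (auto simp: odd_card_pair[OF ne(4)] W t3_def)
  have dist: "distinct [{c0, c1}, {c1, c2}, {c2, c3}, {c3, c0}]"
    using assms(2) by (auto simp: doubleton_eq_iff)
  have "even (card (S \<inter> {{c0, c1}, {c1, c2}, {c2, c3}, {c3, c0}}))"
    using even unfolding sides[symmetric] by blast
  then have "(({c0, c1} \<in> S) \<noteq> ({c1, c2} \<in> S)) = (({c2, c3} \<in> S) \<noteq> ({c3, c0} \<in> S))"
    unfolding even_card_four[OF dist] .
  then have s3: "{c2, c3} \<in> S \<longleftrightarrow> odd (card ({c2, c3} \<inter> W))"
    using s1 s2 s4 unfolding odd_card_pair[OF ne(1)] odd_card_pair[OF ne(2)] odd_card_pair[OF ne(3)]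
      odd_card_pair[OF ne(4)] by argo
  have "e \<in> S \<longleftrightarrow> odd (card (e \<inter> W))" if "e \<in> qubits (insert p Q)" for e
  proof (cases "e \<in> qubits Q")
    case True
    then show ?thesis
      using U old by simp
  next
    case False
    then have "e \<in> sides p"
      using that by (auto simp: qubits_def)
    then show ?thesis
      using s1 s2 s3 s4 unfolding sides by blast
  qed
  then show "\<exists>W. \<forall>e\<in>qubits (insert p Q). e \<in> S \<longleftrightarrow> odd (card (e \<inter> W))"
    by blast
qed

text \<open>Opposite neighbours are never both in \<open>Q\<close>, so some neighbour is in
  \<open>Q\<close> while the clockwise next one is not. The corners are listed counterclockwise,
  beginning with the side shared with that neighbour; \<open>around_cell\<close> then shows that the
  last corner is new.\<close>

lemma even_sets_are_cuts_insert_adj: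
  assumes Q: "polyomino Q" "card Q \<le> 4" and p: "(a, b) \<notin> Q" and cuts: "even_sets_are_cuts Q"
    and "q \<in> Q" "cell_adj q (a, b)"
  shows "even_sets_are_cuts (insert (a, b) Q)"
proof -
  have N: "(a, b - 1) \<notin> Q" "(a - 1, b - 1) \<in> Q \<Longrightarrow> (a - 1, b) \<in> Q" "(a + 1, b - 1) \<in> Q \<Longrightarrow> (a + 1, b) \<in> Q"
    if "(a, b + 1) \<in> Q"
    using around_cell[OF Q p, of 0 1] that by auto
  have E: "(a - 1, b) \<notin> Q" "(a - 1, b + 1) \<in> Q \<Longrightarrow> (a, b + 1) \<in> Q" "(a - 1, b - 1) \<in> Q \<Longrightarrow> (a, b - 1) \<in> Q"
    if "(a + 1, b) \<in> Q"
    using around_cell[OF Q p, of 1 0] that by auto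
  have S: "(a, b + 1) \<notin> Q" "(a + 1, b + 1) \<in> Q \<Longrightarrow> (a + 1, b) \<in> Q" "(a - 1, b + 1) \<in> Q \<Longrightarrow> (a - 1, b) \<in> Q"
    if "(a, b - 1) \<in> Q"
    using around_cell[OF Q p, of 0 "-1"] that by auto
  have W: "(a + 1, b) \<notin> Q" "(a + 1, b - 1) \<in> Q \<Longrightarrow> (a, b - 1) \<in> Q" "(a + 1, b + 1) \<in> Q \<Longrightarrow> (a, b + 1) \<in> Q"
    if "(a - 1, b) \<in> Q"
    using around_cell[OF Q p, of "-1" 0] that by auto
  let ?NE = "(a + 1, b + 1)" and ?NW = "(a, b + 1)" and ?SW = "(a, b)" and ?SE = "(a + 1, b)"
  have sd: "sides (a, b) = {{?NE, ?NW}, {?NW, ?SW}, {?SW, ?SE}, {?SE, ?NE}}"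
    by (auto simp: insert_commute)
  have pairs: "{?NE, ?NW} \<in> qubits Q \<longleftrightarrow> (a, b + 1) \<in> Q" "{?NW, ?SW} \<in> qubits Q \<longleftrightarrow> (a - 1, b) \<in> Q"
    "{?SW, ?SE} \<in> qubits Q \<longleftrightarrow> (a, b - 1) \<in> Q" "{?SE, ?NE} \<in> qubits Q \<longleftrightarrow> (a + 1, b) \<in> Q"
    using p mem_qubits(1)[of a "b + 1" Q] mem_qubits(1)[of a b Q] mem_qubits(2)[of a b Q]
      mem_qubits(2)[of "a + 1" b Q] by (auto simp: insert_commute)
  consider "(a, b + 1) \<in> Q" "(a + 1, b) \<notin> Q" | "(a - 1, b) \<in> Q" "(a, b + 1) \<notin> Q"
    | "(a, b - 1) \<in> Q" "(a - 1, b) \<notin> Q" | "(a + 1, b) \<in> Q" "(a, b - 1) \<notin> Q"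
  proof -
    have "q \<in> {(a, b + 1), (a - 1, b), (a, b - 1), (a + 1, b)}"
      using assms(6) by (cases q) (auto simp: cell_adj_def abs_if split: if_splits)
    then show thesis
      using that N(1) E(1) S(1) W(1) assms(5) by blast
  qed
  then show ?thesis
  proof cases
    case 1
    then show ?thesis
      using N p
      by (intro even_sets_are_cuts_insert[OF cuts, of ?NE ?NW ?SW ?SE]) (auto simp: pairs sd mem_verts)
  next
    case 2
    then show ?thesis
      using W p
      by (intro even_sets_are_cuts_insert[OF cuts, of ?NW ?SW ?SE ?NE]) (auto simp: pairs sd mem_verts)
  next
    case 3
    then show ?thesis
      using S p
      by (intro even_sets_are_cuts_insert[OF cuts, of ?SW ?SE ?NE ?NW]) (auto simp: pairs sd mem_verts)
  next
    case 4
    then show ?thesis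
      using E p
      by (intro even_sets_are_cuts_insert[OF cuts, of ?SE ?NE ?NW ?SW]) (auto simp: pairs sd mem_verts)
  qed
qed

text \<open>A sub-polyomino grows cell by cell inside \<open>P\<close>. Each insertion starts from
  at most four cells, which is where the bound 5 comes from.\<close>

lemma even_sets_are_cuts_small:
  assumes "polyomino P" "card P \<le> 5"
  shows "even_sets_are_cuts P"
proof -
  have P: "finite P" "P \<noteq> {}"
    using assms(1) by (simp_all add: polyomino_def)
  have "\<exists>Q\<subseteq>P. polyomino Q \<and> card Q = Suc k \<and> even_sets_are_cuts Q" if "Suc k \<le> card P" for k
    using that
  proof (induction k)
    case 0
    obtain a b where "(a, b) \<in> P"
      using P(2) by auto
    moreover have "even_sets_are_cuts {(a, b)}"
      by (intro even_sets_are_cuts_insert[of "{}" "(a + 1, b + 1)" "(a, b + 1)" "(a, b)" "(a + 1, b)"])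
        (auto simp: even_sets_are_cuts_def qubits_def verts_def insert_commute)
    ultimately show ?case
      by (intro exI[of _ "{(a, b)}"]) (simp add: polyomino_def)
  next
    case (Suc k)
    then obtain Q where Q: "Q \<subseteq> P" "polyomino Q" "card Q = Suc k" "even_sets_are_cuts Q"
      by auto
    then have "Q \<noteq> {}" "Q \<noteq> P"
      using Suc.prems by auto
    then obtain q y where y: "q \<in> Q" "y \<in> P - Q" "cell_adj q y"
      using polyomino_boundary[OF assms(1) Q(1)] by blast
    moreover have "even_sets_are_cuts (insert y Q)"
      using even_sets_are_cuts_insert_adj[OF Q(2) _ _ Q(4) y(1), of "fst y" "snd y"] y Q(3) Suc.prems assms(2)
      by simp
    ultimately show ?case
      using Q polyomino_insert[OF Q(2) y(1,3)] finite_subset[OF Q(1) P(1)]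
      by (intro exI[of _ "insert y Q"]) auto
  qed
  from this[of "card P - 1"] obtain Q where "Q \<subseteq> P" "card Q = card P" "even_sets_are_cuts Q"
    using P by (auto simp: Suc_diff_1 card_gt_0_iff)
  then show ?thesis
    using card_subset_eq[OF P(1)] by blast
qed

text \<open>In the product of the stars of all vertices in \<open>U\<close>, an edge with both ends
  in \<open>U\<close> cancels and the cut of \<open>U\<close> remains.\<close>

lemma cut_stabilizes:
  assumes "finite P" "state (qubits P) \<psi>"
    and stars: "\<And>s. s \<in> verts P \<Longrightarrow> prod_op (qubits P) (star P s) sigma_x \<psi> = \<psi>"
    and "U \<subseteq> verts P"
  shows "prod_op (qubits P) {e \<in> qubits P. odd (card (e \<inter> U))} sigma_x \<psi> = \<psi>"
proof -
  have "finite U"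
    using assms(1,4) finite_subset finite_verts by blast
  then show ?thesis
    using assms(4)
  proof (induction U rule: finite_induct)
    case empty
    have "tensor_op (qubits P) (\<lambda>i. mat 1) \<psi> = \<psi>"
      using assms(1,2) by (intro tensor_op_id finite_qubits) (auto simp: state_def)
    then show ?case
      by (simp add: prod_op_def)
  next
    case (insert s U)
    let ?C = "\<lambda>U. {e \<in> qubits P. odd (card (e \<inter> U))}"
    have "odd (card (e \<inter> insert s U)) \<longleftrightarrow> odd (card (e \<inter> U)) \<noteq> (s \<in> e)" if "e \<in> qubits P" for e
      using finite_qubit[OF that] insert.hyps by (cases "s \<in> e") simp_all
    then have "?C (insert s U) = {e \<in> qubits P. odd (card (e \<inter> U)) \<noteq> (s \<in> e)}"
      by blast
    then have "?C (insert s U) = (star P s - ?C U) \<union> (?C U - star P s)"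
      unfolding star_def by blast
    moreover have "sigma_x ** sigma_x = mat 1"
      by (simp add: sigma_eq_weyl weyl_mult)
    ultimately have "prod_op (qubits P) (?C (insert s U)) sigma_x \<psi> =
        prod_op (qubits P) (star P s) sigma_x (prod_op (qubits P) (?C U) sigma_x \<psi>)"
      using prod_op_comp_sym_diff[OF finite_qubits[OF assms(1)]] by simp
    then show ?case
      using insert stars by simp
  qed
qed

section \<open>Local graph states for small polyominoes\<close>

lemma sides_is_cycle:
  assumes "p \<in> P"
  shows "is_cycle P (sides p)"
proof -
  obtain a b where p: "p = (a, b)"
    by (cases p)
  let ?vs = "[(a, b), (a + 1, b), (a + 1, b + 1), (a, b + 1)]"
  have "{..<length ?vs} = {0, 1, 2, 3}"
    by auto
  then have "sides p = (\<lambda>i. {?vs ! i, ?vs ! (Suc i mod length ?vs)}) ` {..<length ?vs}"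
    by (simp add: p) blast
  moreover have "sides p \<subseteq> qubits P"
    using assms by (auto simp: qubits_def)
  ultimately show ?thesis
    unfolding is_cycle_def by (intro conjI exI[of _ ?vs]) auto
qed

text \<open>The generator at a private side \<open>f p\<close> pulls back to the plaquette of
  \<open>p\<close>. The generator at another edge \<open>v\<close> pulls back to
  \<open>sigma_x\<close> on \<open>v\<close> and on the private sides of the squares containing
  \<open>v\<close>. This set meets every plaquette evenly, so it is a cut and stabilizes
  \<psi>.\<close>

lemma ex_local_graph_state:
  assumes P: "finite P" "even_sets_are_cuts P" and \<psi>: "toric_ground_state P \<psi>"
    and free: "\<And>p. p \<in> P \<Longrightarrow> \<exists>e\<in>sides p. \<forall>q\<in>P. e \<in> sides q \<longrightarrow> q = p"
  shows "\<exists>G \<phi>. simple_graph (qubits P) G \<and> graph_state (qubits P) G \<phi> \<and>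
    lc_equivalent (qubits P) \<psi> \<phi> \<and> local_graph P G"
proof -
  let ?Q = "qubits P"
  have finQ: "finite ?Q" and st: "state ?Q \<psi>"
    using finite_qubits[OF P(1)] \<psi> by (auto simp: toric_ground_state_def)
  obtain f where f: "\<And>p. p \<in> P \<Longrightarrow> f p \<in> sides p" "\<And>p q. p \<in> P \<Longrightarrow> q \<in> P \<Longrightarrow> f p \<in> sides q \<Longrightarrow> q = p"
    using free by metis
  have inj: "p = q" if "p \<in> P" "q \<in> P" "f p = f q" for p q
    using f that by metis
  have sidesQ: "e \<in> ?Q" if "p \<in> P" "e \<in> sides p" for e p
    using that by (auto simp: qubits_def)
  define G where "G = (\<Union>p\<in>P. \<Union>e\<in>sides p - {f p}. {(f p, e), (e, f p)})"
  define U where "U i = (if i \<in> f ` P then hadamard else mat 1)" for i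
  have G_f: "G `` {f p} = sides p - {f p}" if "p \<in> P" for p
    using that f inj unfolding G_def by blast
  have G_e: "G `` {e} = {f p |p. p \<in> P \<and> e \<in> sides p}" if "e \<notin> f ` P" for e
    using that unfolding G_def by blast
  have simple: "simple_graph ?Q G"
    unfolding simple_graph_def sym_def irrefl_def G_def using f(1) sidesQ by blast
  have vic: "local_graph P G"
    unfolding local_graph_def vicinal_def G_def using f(1) by blast
  have U: "U i \<in> clifford_group" for i
    by (simp add: U_def hadamard_clifford id_clifford)
  let ?\<phi> = "tensor_op ?Q U \<psi>"
  have "lc_equivalent ?Q \<psi> ?\<phi>"
    unfolding lc_equivalent_def by (intro exI[of _ U]) (simp add: U)
  moreover have "state ?Q ?\<phi>"
    using U by (intro state_tensor_op finQ st) (simp add: clifford_group_def)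
  moreover have "prod_op ?Q {v} sigma_x (prod_op ?Q (G `` {v}) sigma_z ?\<phi>) = ?\<phi>" if v: "v \<in> ?Q" for v
  proof -
    \<comment> \<open>It suffices to move the generator past \<open>U\<close> site by site, leaving
      a single kind of Pauli operator on \<open>A\<close>.\<close>
    have pull: "prod_op ?Q {v} sigma_x (prod_op ?Q (G `` {v}) sigma_z ?\<phi>) = tensor_op ?Q U (prod_op ?Q A M \<psi>)"
      if "\<And>i. (if i = v then sigma_x else mat 1) ** ((if i \<in> G `` {v} then sigma_z else mat 1) ** U i)
        = U i ** (if i \<in> A then M else mat 1)" for A M
      unfolding prod_op_def tensor_op_comp[OF finQ] by (intro fun_cong[OF tensor_op_cong]) (use that in simp)
    show ?thesis
    proof (cases "v \<in> f ` P")
      case True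
      then obtain p where p: "p \<in> P" "v = f p"
        by blast
      have other: "i \<notin> f ` P" if "i \<in> sides p" "i \<noteq> f p" for i
        using that f(2) p(1) by blast
      have "prod_op ?Q {v} sigma_x (prod_op ?Q (G `` {v}) sigma_z ?\<phi>) = tensor_op ?Q U (prod_op ?Q (sides p) sigma_z \<psi>)"
        using f(1)[OF p(1)] p(1) other
        by (intro pull) (auto simp: p(2) G_f[OF p(1)] U_def hadamard_mult)
      then show ?thesis
        using \<psi> sides_is_cycle[OF p(1)] by (simp add: toric_ground_state_def)
    next
      case False
      define C where "C = {v} \<union> {f p |p. p \<in> P \<and> v \<in> sides p}"
      have "even (card (C \<inter> sides p))" if p: "p \<in> P" for p
      proof (cases "v \<in> sides p")
        case True
        then have "C \<inter> sides p = {v, f p}"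
          using f p unfolding C_def by blast
        moreover have "v \<noteq> f p"
          using False p by blast
        ultimately show ?thesis
          by simp
      next
        case False
        then have "C \<inter> sides p = {}"
          using f p unfolding C_def by blast
        then show ?thesis
          by simp
      qed
      then obtain W where W: "\<And>e. e \<in> ?Q \<Longrightarrow> e \<in> C \<longleftrightarrow> odd (card (e \<inter> W))"
        using P(2) unfolding even_sets_are_cuts_def by blast
      have "C \<subseteq> ?Q"
        using v f(1) sidesQ unfolding C_def by blast
      \<comment> \<open>The set \<open>W\<close> may contain points that are not vertices of
        \<open>P\<close>; these touch no edge of \<open>P\<close>.\<close>
      moreover have "e \<inter> (W \<inter> verts P) = e \<inter> W" if "e \<in> ?Q" for e
        using qubit_subset_verts[OF that] by blast
      ultimately have "C = {e \<in> ?Q. odd (card (e \<inter> (W \<inter> verts P)))}"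
        using W by auto
      then have "prod_op ?Q C sigma_x \<psi> = \<psi>"
        using cut_stabilizes[OF P(1) st, of "W \<inter> verts P"] \<psi> by (simp add: toric_ground_state_def)
      moreover have "prod_op ?Q {v} sigma_x (prod_op ?Q (G `` {v}) sigma_z ?\<phi>) = tensor_op ?Q U (prod_op ?Q C sigma_x \<psi>)"
      proof (rule pull)
        fix i
        have "i \<in> C \<longleftrightarrow> i = v \<or> i \<in> G `` {v}" "i \<in> G `` {v} \<Longrightarrow> i \<in> f ` P" "v \<notin> G `` {v}"
          using False unfolding C_def G_e[OF False] by blast+
        then show "(if i = v then sigma_x else mat 1) ** ((if i \<in> G `` {v} then sigma_z else mat 1) ** U i)
            = U i ** (if i \<in> C then sigma_x else mat 1)"
          using False by (cases "i = v"; cases "i \<in> G `` {v}") (simp_all add: U_def hadamard_mult)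
      qed
      ultimately show ?thesis
        by simp
    qed
  qed
  ultimately show ?thesis
    using simple vic unfolding graph_state_def by blast
qed

section \<open>The plus-shaped pentomino\<close>

lemma polyomino_plus: "polyomino plus_pentomino"
proof -
  have "polyomino {(0, 0)}"
    by (simp add: polyomino_def)
  then have "polyomino {(0, -1), (0, 0)}"
    by (rule polyomino_insert) (auto simp: cell_adj_def)
  then have "polyomino {(0, 1), (0, -1), (0, 0)}"
    by (rule polyomino_insert[of _ "(0, 0)"]) (auto simp: cell_adj_def)
  then have "polyomino {(-1, 0), (0, 1), (0, -1), (0, 0)}"
    by (rule polyomino_insert[of _ "(0, 0)"]) (auto simp: cell_adj_def)
  then have "polyomino {(1, 0), (-1, 0), (0, 1), (0, -1), (0, 0)}"
    by (rule polyomino_insert[of _ "(0, 0)"]) (auto simp: cell_adj_def)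
  then show ?thesis
    by (simp add: plus_pentomino_def insert_commute)
qed

section \<open>Clockwise coordinates for the arms of the plus\<close>

definition corner :: "nat \<Rightarrow> int \<times> int" where
  "corner i = [(0, 1), (1, 1), (1, 0), (0, 0)] ! (i mod 4)"

text \<open>The side of the central cell facing \<open>dir i\<close> joins \<open>corner i\<close>
  and \<open>corner (i + 1)\<close>. As the central cell is \<open>(0, 0)\<close>,
  \<open>dir i\<close> is both the step to arm \<open>i\<close> and the cell of that arm.\<close>

definition dir :: "nat \<Rightarrow> int \<times> int" where
  "dir i = [(0, 1), (1, 0), (0, -1), (-1, 0)] ! (i mod 4)"

definition "inner_side i = {corner i, corner (i + 1)}"
definition "outer_side i = {corner i + dir i, corner (i + 1) + dir i}"
definition "left_side i = {corner i, corner i + dir i}"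
definition "right_side i = {corner (i + 1), corner (i + 1) + dir i}"

declare One_nat_def [simp del] add_2_eq_Suc [simp del] add_2_eq_Suc' [simp del]

text \<open>The index reaches 7: residue 3, offset 3, and 1 more for the second end of a
  side.\<close>

lemma corner_values:
  "corner (4 * m) = (0, 1)" "corner (4 * m + 1) = (1, 1)" "corner (4 * m + 2) = (1, 0)" "corner (4 * m + 3) = (0, 0)"
  "corner (4 * m + 4) = (0, 1)" "corner (4 * m + 5) = (1, 1)" "corner (4 * m + 6) = (1, 0)" "corner (4 * m + 7) = (0, 0)"
  by (simp_all add: corner_def nth_Cons')

lemma dir_values:
  "dir (4 * m) = (0, 1)" "dir (4 * m + 1) = (1, 0)" "dir (4 * m + 2) = (0, -1)" "dir (4 * m + 3) = (-1, 0)"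
  "dir (4 * m + 4) = (0, 1)" "dir (4 * m + 5) = (1, 0)" "dir (4 * m + 6) = (0, -1)"
  by (simp_all add: dir_def nth_Cons')

lemmas side_defs = inner_side_def outer_side_def left_side_def right_side_def add.assoc corner_values dir_values

text \<open>With an index in one of these forms, \<open>side_defs\<close> evaluates the sides
  without modular arithmetic.\<close>

lemma mod_four_cases:
  obtains m where "i = 4 * m" | m where "i = 4 * m + 1" | m where "i = 4 * m + 2" | m where "i = 4 * m + (3::nat)"
proof -
  have "i = 4 * (i div 4) + i mod 4" "i mod 4 = 0 \<or> i mod 4 = 1 \<or> i mod 4 = 2 \<or> i mod 4 = 3"
    by presburger+
  then show ?thesis
    using that by (metis add.right_neutral)
qed

lemma sides_arm: "sides (dir i) = {inner_side i, outer_side i, left_side i, right_side i}"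
  by (rule mod_four_cases[of i]) (simp_all add: side_defs insert_commute)

lemma sides_centre: "sides (0, 0) = {inner_side i, inner_side (i + 1), inner_side (i + 2), inner_side (i + 3)}"
  by (rule mod_four_cases[of i]) (simp_all add: side_defs insert_commute)

lemma star_Int: "star P s = qubits P \<inter> {e. s \<in> e}"
  by (auto simp: star_def)

lemma stars_plus:
  "star plus_pentomino (corner i + dir i) = {left_side i, outer_side i}"
  "star plus_pentomino (corner (i + 1) + dir i) = {right_side i, outer_side i}"
  "star plus_pentomino (corner (i + 1)) = {inner_side i, inner_side (i + 1), right_side i, left_side (i + 1)}"
  by (rule mod_four_cases[of i];
      simp add: star_Int qubits_def plus_pentomino_def Int_insert_left side_defs insert_commute)+

lemma card_qubits_plus: "card (qubits plus_pentomino) = 16"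
  by (simp add: qubits_def plus_pentomino_def card_insert_if doubleton_eq_iff)

lemma sides_neq:
  "inner_side i \<noteq> outer_side j" "inner_side i \<noteq> left_side j" "inner_side i \<noteq> right_side j"
  "outer_side i \<noteq> left_side j" "outer_side i \<noteq> right_side j" "left_side i \<noteq> right_side j"
  by (rule mod_four_cases[of i]; rule mod_four_cases[of j]; simp add: side_defs doubleton_eq_iff)+

lemma sides_neq_shift:
  "k \<in> {1, 2, 3} \<Longrightarrow> inner_side i \<noteq> inner_side (i + k)"
  "k \<in> {1, 2, 3} \<Longrightarrow> outer_side i \<noteq> outer_side (i + k)"
  by (elim insertE emptyE; rule mod_four_cases[of i]; simp add: side_defs doubleton_eq_iff)+

lemma sides_in_plus:
  "inner_side i \<in> qubits plus_pentomino" "outer_side i \<in> qubits plus_pentomino"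
  "left_side i \<in> qubits plus_pentomino" "right_side i \<in> qubits plus_pentomino"
  "dir i \<in> plus_pentomino" "(0, 0) \<in> plus_pentomino"
proof -
  show dir: "dir i \<in> plus_pentomino"
    by (rule mod_four_cases[of i]) (simp_all add: dir_values plus_pentomino_def)
  then have "sides (dir i) \<subseteq> qubits plus_pentomino"
    unfolding qubits_def by blast
  then show "inner_side i \<in> qubits plus_pentomino" "outer_side i \<in> qubits plus_pentomino"
    "left_side i \<in> qubits plus_pentomino" "right_side i \<in> qubits plus_pentomino"
    by (simp_all add: sides_arm)
qed (simp add: plus_pentomino_def)

lemma corners_in_plus: "corner i + dir i \<in> verts plus_pentomino" "corner (i + 1) + dir i \<in> verts plus_pentomino"
  "corner (i + 1) \<in> verts plus_pentomino"
proof -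
  have "inner_side i \<union> outer_side i \<subseteq> verts plus_pentomino"
    using qubit_subset_verts sides_in_plus by blast
  then show "corner i + dir i \<in> verts plus_pentomino" "corner (i + 1) + dir i \<in> verts plus_pentomino"
    "corner (i + 1) \<in> verts plus_pentomino"
    by (auto simp: inner_side_def outer_side_def)
qed

lemma side_period: "inner_side (i + 4) = inner_side i" "outer_side (i + 4) = outer_side i"
  "left_side (i + 4) = left_side i" "right_side (i + 4) = right_side i"
proof -
  have "corner (j + 4) = corner j" "dir (j + 4) = dir j" for j
    by (simp_all add: corner_def dir_def)
  moreover have "i + 4 + 1 = (i + 1) + 4"
    by simp
  ultimately show "inner_side (i + 4) = inner_side i" "outer_side (i + 4) = outer_side i"
    "left_side (i + 4) = left_side i" "right_side (i + 4) = right_side i"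
    unfolding inner_side_def outer_side_def left_side_def right_side_def by metis+
qed

text \<open>A common star would put its vertex into both edges.\<close>

lemma not_vicinalI:
  assumes "u \<inter> w = {}" "\<And>p. p \<in> P \<Longrightarrow> u \<in> sides p \<Longrightarrow> w \<notin> sides p"
  shows "\<not> vicinal P u w"
  using assms unfolding vicinal_def star_def by blast

lemma not_vicinal_plus:
  "k \<in> {1, 2, 3} \<Longrightarrow> \<not> vicinal plus_pentomino (outer_side i) (inner_side (i + k))"
  "k \<in> {1, 2, 3} \<Longrightarrow> \<not> vicinal plus_pentomino (outer_side i) (outer_side (i + k))"
  "k \<in> {1, 2, 3} \<Longrightarrow> \<not> vicinal plus_pentomino (inner_side i) (outer_side (i + k))"
  "k \<in> {2, 3} \<Longrightarrow> \<not> vicinal plus_pentomino (inner_side i) (left_side (i + k))"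
  "k \<in> {1, 2} \<Longrightarrow> \<not> vicinal plus_pentomino (inner_side i) (right_side (i + k))"
  by (rule not_vicinalI; elim insertE emptyE; rule mod_four_cases[of i];
      auto simp: plus_pentomino_def side_defs doubleton_eq_iff)+

text \<open>Commutation with stars and plaquettes gives the parity assumptions of
  \<open>plus_generators\<close>, and locality gives its non-adjacencies.\<close>

lemma plus_not_local:
  assumes \<psi>: "toric_ground_state plus_pentomino \<psi>" and G: "simple_graph (qubits plus_pentomino) G"
    and "graph_state (qubits plus_pentomino) G \<phi>" "lc_equivalent (qubits plus_pentomino) \<psi> \<phi>"
  shows "\<not> local_graph plus_pentomino G"
proof
  assume local: "local_graph plus_pentomino G"
  let ?P = plus_pentomino
  let ?Q = "qubits ?P"
  have fin: "finite ?Q"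
    by (intro finite_qubits) (simp add: plus_pentomino_def)
  have st: "state ?Q \<psi>"
    using \<psi> by (simp add: toric_ground_state_def)
  obtain ax az bx bz where bits: "\<And>v. v \<in> ?Q \<Longrightarrow> (ax v \<and> bz v) \<noteq> (az v \<and> bx v)"
    and z: "\<And>v A. v \<in> ?Q \<Longrightarrow> prod_op ?Q A sigma_x \<psi> = \<psi> \<Longrightarrow>
       even (card {w\<in>?Q. w \<in> A \<and> (if w = v then az v else (v, w) \<in> G \<and> bz w)})"
    and x: "\<And>v A. v \<in> ?Q \<Longrightarrow> prod_op ?Q A sigma_z \<psi> = \<psi> \<Longrightarrow>
       even (card {w\<in>?Q. w \<in> A \<and> (if w = v then ax v else (v, w) \<in> G \<and> bx w)})"
    by (rule pulled_back_generators[OF fin st G assms(3,4)]) (rule that)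
  define X where "X v w = (if w = v then ax v else (v, w) \<in> G \<and> bx w)" for v w
  define Z where "Z v w = (if w = v then az v else (v, w) \<in> G \<and> bz w)" for v w
  have Zs: "even (card ({w. Z v w} \<inter> star ?P s))" if "v \<in> ?Q" "s \<in> verts ?P" for v s
  proof -
    have "{w \<in> ?Q. w \<in> star ?P s \<and> (if w = v then az v else (v, w) \<in> G \<and> bz w)} = {w. Z v w} \<inter> star ?P s"
      by (auto simp: star_def Z_def)
    then show ?thesis
      using z[OF that(1), of "star ?P s"] \<psi> that(2) by (simp add: toric_ground_state_def)
  qed
  have Xs: "even (card ({w. X v w} \<inter> sides p))" if "v \<in> ?Q" "p \<in> ?P" for v p
  proof -
    have "{w \<in> ?Q. w \<in> sides p \<and> (if w = v then ax v else (v, w) \<in> G \<and> bx w)} = {w. X v w} \<inter> sides p"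
      using that(2) by (auto simp: qubits_def X_def)
    then show ?thesis
      using x[OF that(1), of "sides p"] \<psi> sides_is_cycle[OF that(2)] by (simp add: toric_ground_state_def)
  qed
  have even2: "even (card ({w. R w} \<inter> {a, b})) \<longleftrightarrow> R a = R b" if "a \<noteq> b" for R and a b :: qubit
    using that by (simp add: Int_insert_right)
  have no_edge: "(u, w) \<notin> G" if "\<not> vicinal ?P u w" for u w
    using local that unfolding local_graph_def by blast
  interpret plus_generators inner_side outer_side left_side right_side ?Q X Z "\<lambda>v w. (v, w) \<in> G" bx bz
  proof
    show "((v, w) \<in> G) = ((w, v) \<in> G)" for v w
      using G by (auto simp: simple_graph_def sym_def)
    show "X v w = ((v, w) \<in> G \<and> bx w)" "Z v w = ((v, w) \<in> G \<and> bz w)" if "v \<noteq> w" for v w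
      using that by (auto simp: X_def Z_def)
    show "(X v v \<and> bz v) \<noteq> (Z v v \<and> bx v)" if "v \<in> ?Q" for v
      using bits[OF that] by (simp add: X_def Z_def)
    fix v i
    assume v: "v \<in> ?Q"
    show "Z v (left_side i) = Z v (outer_side i)" "Z v (right_side i) = Z v (outer_side i)"
      using Zs[OF v corners_in_plus(1), of i] Zs[OF v corners_in_plus(2), of i]
        even2[OF sides_neq(4)[symmetric], of "Z v"] even2[OF sides_neq(5)[symmetric], of "Z v"]
      by (simp_all add: stars_plus)
    show "(Z v (inner_side i) \<noteq> Z v (inner_side (i + 1))) = (Z v (right_side i) \<noteq> Z v (left_side (i + 1)))"
      using Zs[OF v corners_in_plus(3), of i] sides_neq sides_neq_shift[of 1]
      by (subst (asm) stars_plus, subst (asm) even_card_four) (simp_all, metis)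
    show "(X v (inner_side i) \<noteq> X v (outer_side i)) = (X v (left_side i) \<noteq> X v (right_side i))"
      using Xs[OF v sides_in_plus(5), of i] sides_neq
      by (subst (asm) sides_arm, subst (asm) even_card_four) simp_all
    show "(X v (inner_side i) \<noteq> X v (inner_side (i + 1))) = (X v (inner_side (i + 2)) \<noteq> X v (inner_side (i + 3)))"
    proof -
      have "distinct [inner_side i, inner_side (i + 1), inner_side (i + 2), inner_side (i + 3)]"
        using sides_neq_shift(1)[of 1 i] sides_neq_shift(1)[of 2 i] sides_neq_shift(1)[of 3 i]
          sides_neq_shift(1)[of 1 "i + 1"] sides_neq_shift(1)[of 2 "i + 1"] sides_neq_shift(1)[of 1 "i + 2"]
        by (simp add: add.assoc)
      from even_card_four[OF this, of "{w. X v w}"] show ?thesis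
        using Xs[OF v sides_in_plus(6)] unfolding sides_centre[of i] by simp
    qed
  qed (use side_period sides_in_plus sides_neq sides_neq_shift no_edge not_vicinal_plus in simp_all)
  show False
    by (rule contradiction)
qed

theorem mainTheorem2:
  "polyomino plus_pentomino \<and> card plus_pentomino = 5 \<and> card (qubits plus_pentomino) = 16 \<and>
   (\<forall>\<psi> G \<phi>. toric_ground_state plus_pentomino \<psi> \<and>
       simple_graph (qubits plus_pentomino) G \<and> graph_state (qubits plus_pentomino) G \<phi> \<and>
       lc_equivalent (qubits plus_pentomino) \<psi> \<phi> \<longrightarrow> \<not> local_graph plus_pentomino G) \<and>
   (\<forall>P. polyomino P \<and> (card P < 5 \<or> card (qubits P) < 16) \<longrightarrow>
       (\<forall>\<psi>. toric_ground_state P \<psi> \<longrightarrow>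
          (\<exists>G \<phi>. simple_graph (qubits P) G \<and> graph_state (qubits P) G \<phi> \<and>
             lc_equivalent (qubits P) \<psi> \<phi> \<and> local_graph P G)))"
proof (intro conjI allI impI)
  fix P \<psi>
  assume P: "polyomino P \<and> (card P < 5 \<or> card (qubits P) < 16)" and \<psi>: "toric_ground_state P \<psi>"
  then have fin: "finite P"
    by (simp add: polyomino_def)
  note small = small_polyomino[OF fin conjunct2[OF P]]
  show "\<exists>G \<phi>. simple_graph (qubits P) G \<and> graph_state (qubits P) G \<phi> \<and>
      lc_equivalent (qubits P) \<psi> \<phi> \<and> local_graph P G"
    using ex_local_graph_state[OF fin even_sets_are_cuts_small[OF conjunct1[OF P] small(1)] \<psi> small(2)] .
next
  show "card plus_pentomino = 5"
    by (simp add: plus_pentomino_def)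
qed (use polyomino_plus card_qubits_plus plus_not_local in blast)+

end
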